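(* Let $\mathbb{F}$ be a field of characteristic zero. There exist a polynomial function $q$ and an absolute constant $c$ such that the following hold for every $n$-variate polynomial $f \in \mathbb{F}[x_1,\dots,x_n]$ of degree $d$ and every polynomial $g \in \mathbb{F}[x_1,\dots,x_n]$ dividing $f$: (1) If $f$ can be computed by an algebraic circuit over $\mathbb{F}$ of size $s$ and depth $\Delta$, then $g$ can be computed by an algebraic circuit over $\mathbb{F}$ of size at most $q(s,d,n)$ and depth at most $\Delta + c$. (2) If $f$ can be computed by an algebraic formula over $\mathbb{F}$ of size $s$, then $g$ can be computed by an algebraic formula over $\mathbb{F}$ of size at most $q(s,d,n)$.
   Context: An algebraic circuit over $\mathbb{F}$ is a directed acyclic graph whose leaves are labelled by variables or field constants, whose internal gates are labelled $+$ or $\times$, and whose edges may carry field constants (scalars); it computes a polynomial at its output gate. Its size is the number of wires (edges) and its depth is the length of the longest path from the output to a leaf. An algebraic formula is an algebraic circuit whose underlying graph is a tree (every gate has fan-out at most one). *)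

theory Defs
  imports Main "HOL-Library.Poly_Mapping"
begin

text \<open>Multivariate polynomials over 'a in the variables x_0, x_1, ...:
  finitely supported maps from monomials (exponent vectors nat =>0 nat) to coefficients.
  Ring operations (and hence dvd) come from HOL-Library.Poly_Mapping.\<close>

type_synonym 'a mpoly = "(nat \<Rightarrow>\<^sub>0 nat) \<Rightarrow>\<^sub>0 'a"

definition mp_var :: "nat \<Rightarrow> 'a::comm_ring_1 mpoly" where
  "mp_var i = Poly_Mapping.single (Poly_Mapping.single i 1) 1"

definition mp_const :: "'a::comm_ring_1 \<Rightarrow> 'a mpoly" where
  "mp_const c = Poly_Mapping.single 0 c"

definition mono_deg :: "(nat \<Rightarrow>\<^sub>0 nat) \<Rightarrow> nat" where
  "mono_deg m = (\<Sum>i\<in>Poly_Mapping.keys m. Poly_Mapping.lookup m i)"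

definition total_degree :: "'a::zero mpoly \<Rightarrow> nat" where
  "total_degree p = Max (insert 0 (mono_deg ` Poly_Mapping.keys p))"

definition in_vars :: "nat \<Rightarrow> 'a::zero mpoly \<Rightarrow> bool" where
  "in_vars n p \<longleftrightarrow> (\<forall>m\<in>Poly_Mapping.keys p. Poly_Mapping.keys m \<subseteq> {..<n})"

text \<open>Algebraic circuits as straight-line programs: a list of gates, gate i may only
  read gates j < i; the output is the last gate. Sum/product gates have unbounded fan-in,
  and every wire (j, c) carries a field scalar c (the value on the wire is c times gate j).\<close>

datatype 'a gate = GVar nat | GConst 'a | GAdd "(nat \<times> 'a) list" | GMul "(nat \<times> 'a) list"

fun gate_children :: "'a gate \<Rightarrow> nat list" where
  "gate_children (GAdd es) = map fst es"
| "gate_children (GMul es) = map fst es"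
| "gate_children _ = []"

fun gate_fanin :: "'a gate \<Rightarrow> nat" where
  "gate_fanin (GAdd es) = length es"
| "gate_fanin (GMul es) = length es"
| "gate_fanin _ = 0"

fun gate_val :: "'a::comm_ring_1 mpoly list \<Rightarrow> 'a gate \<Rightarrow> 'a mpoly" where
  "gate_val vs (GVar i) = mp_var i"
| "gate_val vs (GConst c) = mp_const c"
| "gate_val vs (GAdd es) = sum_list (map (\<lambda>(j, c). mp_const c * vs ! j) es)"
| "gate_val vs (GMul es) = prod_list (map (\<lambda>(j, c). mp_const c * vs ! j) es)"

fun gate_depth :: "nat list \<Rightarrow> 'a gate \<Rightarrow> nat" where
  "gate_depth ds (GAdd es) = Suc (foldr max (map (\<lambda>(j, c). ds ! j) es) 0)"
| "gate_depth ds (GMul es) = Suc (foldr max (map (\<lambda>(j, c). ds ! j) es) 0)"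
| "gate_depth ds _ = 0"

type_synonym 'a circuit = "'a gate list"

definition circ_vals :: "'a::comm_ring_1 circuit \<Rightarrow> 'a mpoly list" where
  "circ_vals C = foldl (\<lambda>vs g. vs @ [gate_val vs g]) [] C"

definition circ_depths :: "'a circuit \<Rightarrow> nat list" where
  "circ_depths C = foldl (\<lambda>ds g. ds @ [gate_depth ds g]) [] C"

definition wf_circuit :: "'a circuit \<Rightarrow> bool" where
  "wf_circuit C \<longleftrightarrow> C \<noteq> [] \<and>
     (\<forall>i<length C. (\<forall>j\<in>set (gate_children (C ! i)). j < i) \<and>
        (case C ! i of GAdd es \<Rightarrow> es \<noteq> [] | GMul es \<Rightarrow> es \<noteq> [] | _ \<Rightarrow> True))"

definition circ_size :: "'a circuit \<Rightarrow> nat" where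
  "circ_size C = (\<Sum>g\<leftarrow>C. gate_fanin g)"

definition circ_depth :: "'a circuit \<Rightarrow> nat" where
  "circ_depth C = last (circ_depths C)"

definition computes :: "'a::comm_ring_1 circuit \<Rightarrow> 'a mpoly \<Rightarrow> bool" where
  "computes C p \<longleftrightarrow> wf_circuit C \<and> last (circ_vals C) = p"

definition is_formula :: "'a circuit \<Rightarrow> bool" where
  "is_formula C \<longleftrightarrow> wf_circuit C \<and>
     (\<forall>j. count_list (concat (map gate_children C)) j \<le> 1)"

end

theory Submission
  imports Defs "Berlekamp_Zassenhaus.Unique_Factorization_Poly" "HOL-Computational_Algebra.Polynomial_FPS"
begin

text \<open>
  Restrict \<open>f\<close> to \<open>F\<^sub>\<beta>(t) = f(a + \<beta> b + t (x - a))\<close>, where \<open>b\<close> is a direction in which \<open>f\<close> is monic up to a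
  scalar and \<open>a\<close> is a generic point, and let \<open>G(t) = g(a + t (x - a))\<close>, so that \<open>g = G(1)\<close>. With
  \<open>y\<close> in place of \<open>\<beta>\<close>, the coefficient of \<open>t ^ m\<close> in the logarithmic derivative of a factor
  \<open>q\<close> of \<open>F\<^sub>y\<close> is a proper fraction in \<open>y\<close> whose denominator is a power of the scalar polynomial
  \<open>q(0, y)\<close>. For generic \<open>a\<close> these denominators are coprime for distinct irreducible factors, so the
  contribution of each irreducible factor is a scalar-linear function (a partial fraction projection) of the
  sum over all factors, and multiplicities are only weights. Hence the \<open>m\<close>-th coefficient of
  \<open>G' / G\<close> is a linear combination, with scalar coefficients, of the \<open>m\<close>-th coefficients of
  \<open>F\<^sub>\<beta>' / F\<^sub>\<beta>\<close> for polynomially many scalars \<open>\<beta>\<close>. Truncated logarithm and exponential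
  series, with coefficients in \<open>t\<close> extracted by interpolation, turn this into a formula for \<open>g\<close> of constant
  depth on top of shifted copies of \<open>f\<close>. No gate is shared by these copies, so formulas stay formulas.
\<close>

text \<open>Only scalars of \<open>'a\<close> can be put on wires, while the factors live over the
  fraction field of the polynomial ring. This obstacle shapes the set-up: the weights of the linear
  combination must be scalars although the numerators of the fractions in \<open>y\<close> are not,
  so the argument may use linearity over \<open>'a\<close> only. It goes through because the
  denominators are scalar, which is due to the line starting, at t = 0, in a point with coordinates
  in \<open>'a\<close>. Depth is the second obstacle: finding a factor by iteration or by linear
  algebra over the fraction field would add layers. Here the unknowns are scalars whose existence
  suffices, and \<open>g\<close> becomes two nested linear combinations of powers. Characteristic
  zero enters three times: multiplicities stay nonzero, the logarithm and exponential series have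
  denominators, and there are enough points. Their number is (d + 1)^2 because a polynomial of
  degree d in a polynomial of degree d has degree d * d, and because denominators of joint degree at
  most d, raised to powers up to d, have to be separated.\<close>

no_notation vec_index (infixl "$" 100)
unbundle fps_syntax
hide_const (open) comm_monoid_mult_class.coprime

section \<open>Evaluation of polynomials\<close>

definition mono_val :: "(nat \<Rightarrow> 'b::comm_ring_1) \<Rightarrow> (nat \<Rightarrow>\<^sub>0 nat) \<Rightarrow> 'b" where
  "mono_val v m = (\<Prod>i\<in>Poly_Mapping.keys m. v i ^ Poly_Mapping.lookup m i)"

text \<open>The coefficient map \<open>h\<close> is kept general so that one function covers values
  at points, substitutions, and restrictions to lines read as polynomials or as power series;
  \<open>hom_meval\<close> passes from one reading to another.\<close>

definition meval :: "('a::comm_ring_1 \<Rightarrow> 'b::comm_ring_1) \<Rightarrow> (nat \<Rightarrow> 'b) \<Rightarrow> 'a mpoly \<Rightarrow> 'b" where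
  "meval h v p = (\<Sum>m\<in>Poly_Mapping.keys p. h (Poly_Mapping.lookup p m) * mono_val v m)"

lemma mono_val_superset:
  assumes "finite S" "Poly_Mapping.keys m \<subseteq> S"
  shows "mono_val v m = (\<Prod>i\<in>S. v i ^ Poly_Mapping.lookup m i)"
  unfolding mono_val_def using assms
  by (intro prod.mono_neutral_left) (auto simp: in_keys_iff)

lemma mono_val_0 [simp]: "mono_val v 0 = 1"
  by (simp add: mono_val_def)

lemma mono_val_add: "mono_val v (m + n) = mono_val v m * mono_val v n"
proof -
  let ?S = "Poly_Mapping.keys m \<union> Poly_Mapping.keys n"
  have "mono_val v (m + n) = (\<Prod>i\<in>?S. v i ^ Poly_Mapping.lookup (m + n) i)"
    using Poly_Mapping.keys_add[of m n] by (intro mono_val_superset) auto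
  also have "\<dots> = (\<Prod>i\<in>?S. v i ^ Poly_Mapping.lookup m i) * (\<Prod>i\<in>?S. v i ^ Poly_Mapping.lookup n i)"
    by (simp add: lookup_add power_add prod.distrib)
  also have "\<dots> = mono_val v m * mono_val v n"
    by (subst (1 2) mono_val_superset[where S = ?S]) auto
  finally show ?thesis .
qed

lemma poly_mapping_eq_sum_single:
  "p = (\<Sum>m\<in>Poly_Mapping.keys p. Poly_Mapping.single m (Poly_Mapping.lookup p m))"
  by (rule poly_mapping_eqI)
    (auto simp: lookup_sum lookup_single when_def in_keys_iff sum.delta)

lemma (in comm_ring_hom) meval_superset:
  assumes "finite S" "Poly_Mapping.keys p \<subseteq> S"
  shows "meval hom v p = (\<Sum>m\<in>S. hom (Poly_Mapping.lookup p m) * mono_val v m)"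
  unfolding meval_def using assms
  by (intro sum.mono_neutral_left) (auto simp: in_keys_iff)

lemma (in comm_ring_hom) meval_single: "meval hom v (Poly_Mapping.single m c) = hom c * mono_val v m"
  by (simp add: meval_def)

lemma (in comm_ring_hom) meval_add: "meval hom v (p + q) = meval hom v p + meval hom v q"
proof -
  let ?S = "Poly_Mapping.keys p \<union> Poly_Mapping.keys q"
  have "meval hom v (p + q) = (\<Sum>m\<in>?S. hom (Poly_Mapping.lookup (p + q) m) * mono_val v m)"
    using Poly_Mapping.keys_add[of p q] by (intro meval_superset) auto
  also have "\<dots> = (\<Sum>m\<in>?S. hom (Poly_Mapping.lookup p m) * mono_val v m) +
      (\<Sum>m\<in>?S. hom (Poly_Mapping.lookup q m) * mono_val v m)"
    by (simp add: lookup_add hom_add distrib_right sum.distrib)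
  also have "\<dots> = meval hom v p + meval hom v q"
    by (subst (1 2) meval_superset[where S = ?S]) auto
  finally show ?thesis .
qed

lemma meval_0 [simp]: "meval h v 0 = 0"
  by (simp add: meval_def)

lemma (in comm_ring_hom) meval_sum: "meval hom v (sum f A) = (\<Sum>x\<in>A. meval hom v (f x))"
  by (induction A rule: infinite_finite_induct) (simp_all add: meval_add)

lemma (in comm_ring_hom) meval_mult: "meval hom v (p * q) = meval hom v p * meval hom v q"
proof -
  have "p * q = (\<Sum>m\<in>Poly_Mapping.keys p. \<Sum>n\<in>Poly_Mapping.keys q.
      Poly_Mapping.single (m + n) (Poly_Mapping.lookup p m * Poly_Mapping.lookup q n))"
    by (subst poly_mapping_eq_sum_single[of p], subst poly_mapping_eq_sum_single[of q])
      (simp add: sum_product mult_single)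
  then have "meval hom v (p * q) = (\<Sum>m\<in>Poly_Mapping.keys p. \<Sum>n\<in>Poly_Mapping.keys q.
      (hom (Poly_Mapping.lookup p m) * mono_val v m) * (hom (Poly_Mapping.lookup q n) * mono_val v n))"
    by (simp add: meval_sum meval_single mono_val_add hom_mult algebra_simps)
  also have "\<dots> = meval hom v p * meval hom v q"
    by (simp add: meval_def sum_product)
  finally show ?thesis .
qed

lemma comm_ring_hom_meval:
  assumes "comm_ring_hom h"
  shows "comm_ring_hom (meval h v)"
proof -
  interpret comm_ring_hom h by fact
  show ?thesis
    by unfold_locales (simp_all add: meval_add meval_mult, simp_all add: meval_def)
qed

lemma (in comm_ring_hom) meval_const: "meval hom v (mp_const c) = hom c"
  by (simp add: mp_const_def meval_single)

lemma (in comm_ring_hom) meval_var: "meval hom v (mp_var i) = v i"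
  by (simp add: mp_var_def meval_single mono_val_def)

lemma (in comm_ring_hom) hom_meval: "hom (meval h v p) = meval (\<lambda>c. hom (h c)) (\<lambda>i. hom (v i)) p"
  by (simp add: meval_def mono_val_def hom_sum hom_mult hom_prod hom_power)

interpretation mp_const_hom: inj_comm_ring_hom "mp_const :: 'a::comm_ring_1 \<Rightarrow> 'a mpoly"
proof unfold_locales
  show "x = 0" if "mp_const x = 0" for x :: 'a
    using arg_cong[OF that, of "\<lambda>p. Poly_Mapping.lookup p 0"] by (simp add: mp_const_def)
qed (auto simp: mp_const_def single_add mult_single)

lemma comm_ring_hom_id: "comm_ring_hom (\<lambda>x. x)"
  by unfold_locales auto

lemma mp_var_power: "(mp_var i :: 'a::comm_ring_1 mpoly) ^ k = Poly_Mapping.single (Poly_Mapping.single i k) 1"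
  by (induction k) (simp_all add: mp_var_def mult_single single_add[symmetric])

lemma meval_mp_var: "meval mp_const mp_var p = (p :: 'a::comm_ring_1 mpoly)"
proof -
  have prod_single: "(\<Prod>i\<in>A. mp_var i ^ f i) = (Poly_Mapping.single (\<Sum>i\<in>A. Poly_Mapping.single i (f i)) 1 :: 'a mpoly)"
    if "finite A" for A f
    using that by (induction A) (simp_all add: mp_var_power mult_single)
  have "mono_val mp_var m = (Poly_Mapping.single m 1 :: 'a mpoly)" for m
    unfolding mono_val_def
    by (subst prod_single) (simp_all add: poly_mapping_eq_sum_single[of m, symmetric])
  then show ?thesis
    by (simp add: meval_def mp_const_def mult_single poly_mapping_eq_sum_single[of p, symmetric])
qed

text \<open>A single factor \<tau> for all variables is enough: at a fixed parameter \<tau> the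
  point a + \<beta> b + \<tau> (x - a) has this shape.\<close>

definition affine_subst :: "'a::comm_ring_1 \<Rightarrow> (nat \<Rightarrow> 'a) \<Rightarrow> 'a mpoly \<Rightarrow> 'a mpoly" where
  "affine_subst \<tau> \<gamma> = meval mp_const (\<lambda>i. mp_const \<tau> * mp_var i + mp_const (\<gamma> i))"

lemma comm_ring_hom_affine_subst: "comm_ring_hom (affine_subst \<tau> \<gamma>)"
  unfolding affine_subst_def by (rule comm_ring_hom_meval) unfold_locales

lemma affine_subst_const [simp]: "affine_subst \<tau> \<gamma> (mp_const c) = mp_const c"
  by (simp add: affine_subst_def mp_const_hom.meval_const)

lemma affine_subst_var [simp]: "affine_subst \<tau> \<gamma> (mp_var i) = mp_const \<tau> * mp_var i + mp_const (\<gamma> i)"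
  by (simp add: affine_subst_def mp_const_hom.meval_var)

section \<open>Points where a nonzero polynomial does not vanish\<close>

lemma base_digits_unique:
  fixes f g :: "nat \<Rightarrow> nat"
  assumes "\<And>i. i < n \<Longrightarrow> f i < M" "\<And>i. i < n \<Longrightarrow> g i < M"
    and "(\<Sum>i<n. f i * M ^ i) = (\<Sum>i<n. g i * M ^ i)" and "i < n"
  shows "f i = g i"
  using assms
proof (induction n arbitrary: f g i)
  case (Suc n)
  have eq: "f 0 + M * (\<Sum>i<n. f (Suc i) * M ^ i) = g 0 + M * (\<Sum>i<n. g (Suc i) * M ^ i)"
    using Suc.prems(3) by (simp only: sum.lessThan_Suc_shift) (simp add: sum_distrib_left ac_simps)
  have lt: "f 0 < M" "g 0 < M"
    using Suc.prems by auto
  have f0: "f 0 = g 0"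
    using arg_cong[OF eq, of "\<lambda>x. x mod M"] lt by simp
  then have "(\<Sum>i<n. f (Suc i) * M ^ i) = (\<Sum>i<n. g (Suc i) * M ^ i)"
    using eq lt by simp
  then have "f (Suc j) = g (Suc j)" if "j < n" for j
    using Suc.IH[of "\<lambda>i. f (Suc i)" "\<lambda>i. g (Suc i)" j] Suc.prems(1,2) that by simp
  then show ?case
    using f0 Suc.prems(4) by (cases i) auto
qed simp

text \<open>Kronecker substitution \<open>x\<^sub>i \<mapsto> z ^ M ^ i\<close> with \<open>M\<close> larger than all exponents.\<close>
lemma ex_meval_nonzero:
  fixes p :: "'a::field mpoly"
  assumes "p \<noteq> 0" and inf: "infinite (UNIV :: 'a set)"
  shows "\<exists>a. meval (\<lambda>x. x) a p \<noteq> 0"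
proof -
  define V where "V = (\<Union>m\<in>Poly_Mapping.keys p. Poly_Mapping.keys m)"
  define E where "E = (\<Union>m\<in>Poly_Mapping.keys p. Poly_Mapping.lookup m ` Poly_Mapping.keys m)"
  have "finite V" "finite E" by (auto simp: V_def E_def)
  define n where "n = Suc (Max (insert 0 V))"
  define M where "M = Suc (Max (insert 0 E))"
  have V: "i < n" if "m \<in> Poly_Mapping.keys p" "i \<in> Poly_Mapping.keys m" for m i
    using that \<open>finite V\<close> by (auto simp: n_def V_def less_Suc_eq_le intro!: Max_ge)
  have M: "Poly_Mapping.lookup m i < M" if "m \<in> Poly_Mapping.keys p" for m i
  proof (cases "i \<in> Poly_Mapping.keys m")
    case True
    then have "Poly_Mapping.lookup m i \<in> E"
      using that by (auto simp: E_def)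
    then show ?thesis
      using \<open>finite E\<close> by (auto simp: M_def less_Suc_eq_le intro!: Max_ge)
  qed (simp add: in_keys_iff M_def)
  define w where "w m = (\<Sum>i<n. Poly_Mapping.lookup m i * M ^ i)" for m :: "nat \<Rightarrow>\<^sub>0 nat"
  have inj: "m = m'" if "m \<in> Poly_Mapping.keys p" "m' \<in> Poly_Mapping.keys p" "w m = w m'" for m m'
  proof (rule poly_mapping_eqI)
    fix i
    show "Poly_Mapping.lookup m i = Poly_Mapping.lookup m' i"
    proof (cases "i < n")
      case True
      then show ?thesis
        using base_digits_unique[of n "Poly_Mapping.lookup m" M "Poly_Mapping.lookup m'" i] M that
        by (simp add: w_def)
    next
      case False
      then show ?thesis
        using V that(1,2) by (metis in_keys_iff)
    qed
  qed
  define P where "P = (\<Sum>m\<in>Poly_Mapping.keys p. monom (Poly_Mapping.lookup p m) (w m))"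
  obtain m\<^sub>0 where m0: "m\<^sub>0 \<in> Poly_Mapping.keys p"
    using \<open>p \<noteq> 0\<close> by (metis ex_in_conv keys_eq_empty)
  \<comment> \<open>\<open>w\<close> is injective on the monomials of \<open>p\<close>, so no other
    term of \<open>P\<close> falls on this exponent and nothing cancels.\<close>
  have "coeff P (w m\<^sub>0) = (\<Sum>m\<in>Poly_Mapping.keys p. if m = m\<^sub>0 then Poly_Mapping.lookup p m else 0)"
    unfolding P_def coeff_sum by (intro sum.cong refl) (use inj m0 in auto)
  also have "\<dots> \<noteq> 0"
    using m0 by (simp add: in_keys_iff)
  finally have "P \<noteq> 0"
    by auto
  then have "finite {z. poly P z = 0}"
    by (rule poly_roots_finite)
  then obtain z where z: "poly P z \<noteq> 0"
    using inf by (metis (mono_tags, lifting) UNIV_I finite_subset mem_Collect_eq subsetI)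
  have "meval (\<lambda>x. x) (\<lambda>i. z ^ (M ^ i)) p = poly P z"
  proof -
    have "mono_val (\<lambda>i. z ^ (M ^ i)) m = z ^ w m" if "m \<in> Poly_Mapping.keys p" for m
      using V[OF that]
      by (subst mono_val_superset[where S = "{..<n}"])
        (auto simp: w_def power_sum power_mult[symmetric] mult.commute)
    then show ?thesis
      by (simp add: meval_def P_def poly_sum poly_monom)
  qed
  with z show ?thesis by metis
qed

section \<open>Degree and top coefficient of a restriction to a line\<close>

lemma coeff_mult_degree_bound:
  assumes "degree p \<le> m" "degree q \<le> n"
  shows "coeff (p * q) (m + n) = coeff p m * coeff q n"
proof -
  have "coeff (p * q) (m + n) = (\<Sum>i\<le>m + n. if i = m then coeff p m * coeff q n else 0)"
    unfolding coeff_mult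
  proof (intro sum.cong refl)
    fix i assume "i \<in> {..m + n}"
    then show "coeff p i * coeff q (m + n - i) = (if i = m then coeff p m * coeff q n else 0)"
      using assms by (cases i m rule: linorder_cases) (auto simp: coeff_eq_0)
  qed
  then show ?thesis by simp
qed

text \<open>The degree may drop when \<open>w\<close> is zero or nilpotent, so the coefficient is
  taken at the bound \<open>k\<close> and not at the degree.\<close>

lemma linear_power_degree_coeff:
  "degree ([:u, w:] ^ k) \<le> k \<and> coeff ([:u, w:] ^ k) k = w ^ k"
  for w :: "'a::comm_ring_1"
proof (induction k)
  case (Suc k)
  have d: "degree [:u, w:] \<le> 1"
    by simp
  have "degree ([:u, w:] * [:u, w:] ^ k) \<le> 1 + k"
    using degree_mult_le[of "[:u, w:]" "[:u, w:] ^ k"] d Suc by linarith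
  moreover have "coeff ([:u, w:] * [:u, w:] ^ k) (1 + k) = w * w ^ k"
    using coeff_mult_degree_bound[OF d, of "[:u, w:] ^ k" k] Suc by simp
  ultimately show ?case
    by (metis plus_1_eq_Suc power_Suc)
qed simp

lemma mono_val_linear_degree_coeff:
  "degree (mono_val (\<lambda>i. [:u i, w i:]) m) \<le> mono_deg m \<and>
   coeff (mono_val (\<lambda>i. [:u i, w i:]) m) (mono_deg m) = mono_val w m"
  for w :: "nat \<Rightarrow> 'a::comm_ring_1"
proof -
  have "degree (\<Prod>i\<in>A. [:u i, w i:] ^ f i) \<le> sum f A \<and>
    coeff (\<Prod>i\<in>A. [:u i, w i:] ^ f i) (sum f A) = (\<Prod>i\<in>A. w i ^ f i)" if "finite A" for A and f :: "nat \<Rightarrow> nat"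
    using that
  proof (induction A)
    case (insert x A)
    let ?p = "[:u x, w x:] ^ f x" and ?q = "\<Prod>i\<in>A. [:u i, w i:] ^ f i"
    have d: "degree ?p \<le> f x" "coeff ?p (f x) = w x ^ f x"
      using linear_power_degree_coeff[of "u x" "w x" "f x"] by auto
    have "degree (?p * ?q) \<le> f x + sum f A"
      using degree_mult_le[of ?p ?q] d(1) insert.IH by linarith
    moreover have "coeff (?p * ?q) (f x + sum f A) = w x ^ f x * (\<Prod>i\<in>A. w i ^ f i)"
      using coeff_mult_degree_bound[OF d(1), of ?q "sum f A"] d(2) insert.IH by simp
    ultimately show ?case
      using insert.hyps by simp
  qed simp
  then show ?thesis
    by (simp add: mono_val_def mono_deg_def)
qed

lemma mono_deg_le_total_degree: "m \<in> Poly_Mapping.keys f \<Longrightarrow> mono_deg m \<le> total_degree f"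
  by (auto simp: total_degree_def)

lemma degree_meval_linear:
  fixes f :: "'a::comm_ring_1 mpoly" and h :: "'a \<Rightarrow> 'b::comm_ring_1"
  shows "degree (meval (\<lambda>c. [:h c:]) (\<lambda>i. [:u i, w i:]) f) \<le> total_degree f"
  unfolding meval_def
proof (intro degree_sum_le)
  fix m assume "m \<in> Poly_Mapping.keys f"
  have "degree ([:h (Poly_Mapping.lookup f m):] * mono_val (\<lambda>i. [:u i, w i:]) m) \<le> degree (mono_val (\<lambda>i. [:u i, w i:]) m)"
    by (simp add: degree_smult_le)
  also have "\<dots> \<le> total_degree f"
    using mono_val_linear_degree_coeff[of u w m] mono_deg_le_total_degree[OF \<open>m \<in> _\<close>] by linarith
  finally show "degree ([:h (Poly_Mapping.lookup f m):] * mono_val (\<lambda>i. [:u i, w i:]) m) \<le> total_degree f" .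
qed simp

text \<open>The homogeneous component of highest degree. Its value at a direction decides whether
  \<open>f\<close> keeps its full degree on lines in that direction.\<close>

definition top_part :: "'a::comm_ring_1 mpoly \<Rightarrow> 'a mpoly" where
  "top_part f = (\<Sum>m\<in>{m\<in>Poly_Mapping.keys f. mono_deg m = total_degree f}. Poly_Mapping.single m (Poly_Mapping.lookup f m))"

lemma top_part_nonzero:
  assumes "f \<noteq> 0"
  shows "top_part f \<noteq> 0"
proof -
  have "Poly_Mapping.keys f \<noteq> {}"
    using assms by simp
  then have "total_degree f \<in> mono_deg ` Poly_Mapping.keys f"
    unfolding total_degree_def by (subst Max_insert) (auto simp: max_def)
  then obtain m where "m \<in> Poly_Mapping.keys f" "mono_deg m = total_degree f"
    by auto
  then have "Poly_Mapping.lookup (top_part f) m \<noteq> 0"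
    by (auto simp: top_part_def lookup_sum lookup_single when_def sum.delta in_keys_iff)
  then show ?thesis
    by auto
qed

text \<open>Only monomials of highest degree reach this coefficient, and each linear factor
  contributes its slope. The base point \<open>u\<close> drops out: with scalar slopes the top
  coefficient is a scalar even if the base point consists of variables.\<close>

lemma coeff_meval_linear_total_degree:
  fixes f :: "'a::comm_ring_1 mpoly" and h :: "'a \<Rightarrow> 'b::comm_ring_1"
  assumes "comm_ring_hom h"
  shows "coeff (meval (\<lambda>c. [:h c:]) (\<lambda>i. [:u i, h (w i):]) f) (total_degree f) = h (meval (\<lambda>x. x) w (top_part f))"
proof -
  interpret comm_ring_hom h by fact
  let ?v = "\<lambda>i. [:u i, h (w i):]"
  have "coeff (meval (\<lambda>c. [:h c:]) ?v f) (total_degree f)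
     = (\<Sum>m\<in>Poly_Mapping.keys f. h (Poly_Mapping.lookup f m) * coeff (mono_val ?v m) (total_degree f))"
    by (simp add: meval_def coeff_sum)
  also have "\<dots> = (\<Sum>m\<in>Poly_Mapping.keys f. if mono_deg m = total_degree f
      then h (Poly_Mapping.lookup f m) * mono_val (\<lambda>i. h (w i)) m else 0)"
  proof (intro sum.cong refl)
    fix m assume m: "m \<in> Poly_Mapping.keys f"
    have "coeff (mono_val ?v m) (total_degree f) = 0" if "mono_deg m \<noteq> total_degree f"
      using mono_val_linear_degree_coeff[of u "\<lambda>i. h (w i)" m] mono_deg_le_total_degree[OF m] that
      by (intro coeff_eq_0) linarith
    then show "h (Poly_Mapping.lookup f m) * coeff (mono_val ?v m) (total_degree f) = (if mono_deg m = total_degree f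
      then h (Poly_Mapping.lookup f m) * mono_val (\<lambda>i. h (w i)) m else 0)"
      using mono_val_linear_degree_coeff[of u "\<lambda>i. h (w i)" m] by auto
  qed
  also have "\<dots> = (\<Sum>m\<in>{m\<in>Poly_Mapping.keys f. mono_deg m = total_degree f}.
      h (Poly_Mapping.lookup f m) * mono_val (\<lambda>i. h (w i)) m)"
    by (subst sum.inter_filter) auto
  also have "\<dots> = h (meval (\<lambda>x. x) w (top_part f))"
    by (simp add: top_part_def comm_ring_hom.meval_sum[OF comm_ring_hom_id] comm_ring_hom.meval_single[OF comm_ring_hom_id] hom_sum hom_mult mono_val_def hom_prod hom_power)
  finally show ?thesis .
qed

lemma of_nat_neq_0_if_char_0:
  "CHAR('a::semiring_1) = 0 \<Longrightarrow> n > 0 \<Longrightarrow> of_nat n \<noteq> (0 :: 'a)"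
  by (simp add: of_nat_eq_0_iff_char_dvd)

lemma infinite_UNIV_if_char_0:
  assumes "CHAR('a::ring_1) = 0"
  shows "infinite (UNIV :: 'a set)"
proof -
  have "inj (of_nat :: nat \<Rightarrow> 'a)"
  proof (rule linorder_injI)
    fix x y :: nat assume "x < y"
    then show "of_nat x \<noteq> (of_nat y :: 'a)"
      using of_nat_neq_0_if_char_0[OF assms, of "y - x"] by (auto simp: of_nat_diff)
  qed
  then show ?thesis
    by (metis finite_imageD finite_subset infinite_UNIV_nat subset_UNIV)
qed

section \<open>Logarithmic derivatives of power series\<close>

definition dlog :: "'a::field fps \<Rightarrow> 'a fps" where
  "dlog s = fps_deriv s * inverse s"

lemma dlog_mult:
  fixes s t :: "'a::field fps"
  assumes "s $ 0 \<noteq> 0" "t $ 0 \<noteq> 0"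
  shows "dlog (s * t) = dlog s + dlog t"
proof -
  have s: "s * inverse s = 1" and t: "t * inverse t = 1"
    using assms by (simp_all add: inverse_mult_eq_1')
  have "dlog (s * t) = (fps_deriv s * inverse s) * (t * inverse t) + (fps_deriv t * inverse t) * (s * inverse s)"
    unfolding dlog_def by (simp add: fps_inverse_mult algebra_simps)
  then show ?thesis
    by (simp add: s t dlog_def)
qed

lemma dlog_const [simp]: "dlog (fps_const c) = 0"
  by (simp add: dlog_def)

lemma dlog_1 [simp]: "dlog 1 = 0"
  by (simp add: dlog_def)

lemma dlog_power:
  assumes "s $ 0 \<noteq> 0"
  shows "dlog (s ^ n) = of_nat n * dlog s"
  by (induction n) (use assms in \<open>simp_all add: dlog_mult algebra_simps fps_nth_power_0\<close>)

lemma fps_nth_0_prod: "prod f I $ 0 = (\<Prod>i\<in>I. f i $ 0)"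
  for f :: "_ \<Rightarrow> 'a::comm_ring_1 fps"
  by (induction I rule: infinite_finite_induct) simp_all

lemma dlog_prod:
  assumes "\<And>i. i \<in> I \<Longrightarrow> f i $ 0 \<noteq> 0"
  shows "dlog (prod f I) = (\<Sum>i\<in>I. dlog (f i))"
  using assms
  by (induction I rule: infinite_finite_induct) (simp_all add: dlog_mult fps_nth_0_prod)

text \<open>Coefficient \<open>m\<close> of \<open>s * dlog s = fps_deriv s\<close> with the newest
  unknown isolated: a recursion that divides by \<open>s $ 0\<close> once per step.\<close>

lemma fps_nth_mult_dlog:
  assumes "s $ 0 \<noteq> 0"
  shows "s $ 0 * dlog s $ m = of_nat (m + 1) * s $ (m + 1) - (\<Sum>i=1..m. s $ i * dlog s $ (m - i))"
proof -
  have "s * dlog s = fps_deriv s * (s * inverse s)"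
    by (simp add: dlog_def algebra_simps)
  also have "\<dots> = fps_deriv s"
    using assms by (simp add: inverse_mult_eq_1')
  finally have "(s * dlog s) $ m = of_nat (m + 1) * s $ (m + 1)"
    by simp
  then show ?thesis
    by (simp add: fps_mult_nth sum.atLeast_Suc_atMost algebra_simps)
qed

lemma poly_fps_const_nth:
  "poly Q (fps_const x) $ i = poly (map_poly (\<lambda>s. s $ i) Q) x"
  for Q :: "'a::comm_ring_1 fps poly"
  by (induction Q) (simp_all add: map_poly_pCons)

text \<open>\<open>Q\<close> is a polynomial in y whose coefficients are series in t. As it is
  monic, only its part at t = 0 has full degree in y; every other t-coefficient has smaller degree.
  Each step of the recursion for \<open>dlog\<close> divides by \<open>q\<close> once more, while
  the numerator stays behind in degree.\<close>

lemma dlog_nth_strictly_proper: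
  fixes Q :: "'a::field fps poly"
  assumes monic: "lead_coeff Q = 1" and deg: "degree Q > 0"
  defines "q \<equiv> map_poly (\<lambda>s. s $ 0) Q"
  shows "\<exists>N. degree N < (m + 1) * degree Q \<and>
    (\<forall>x. poly q x \<noteq> 0 \<longrightarrow> dlog (poly Q (fps_const x)) $ m = poly N x / poly q x ^ (m + 1))"
proof (induction m rule: less_induct)
  case (less m)
  then obtain N where N: "\<And>k. k < m \<Longrightarrow> degree (N k) < (k + 1) * degree Q"
    "\<And>k x. k < m \<Longrightarrow> poly q x \<noteq> 0 \<Longrightarrow> dlog (poly Q (fps_const x)) $ k = poly (N k) x / poly q x ^ (k + 1)"
    by metis
  define P where "P i = map_poly (\<lambda>s. s $ i) Q" for i
  define D where "D = degree Q"
  have P: "poly Q (fps_const x) $ i = poly (P i) x" for x i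
    unfolding P_def by (rule poly_fps_const_nth)
  have q: "q = P 0"
    by (simp add: q_def P_def)
  \<comment> \<open>The leading coefficient of \<open>Q\<close> is the series 1, which has no terms
    of positive order.\<close>
  have dP: "degree (P i) \<le> D - 1" if "i \<ge> 1" for i
  proof (rule degree_le, intro allI impI)
    fix k assume "D - 1 < k"
    then have "k = D \<or> k > D" by auto
    then show "coeff (P i) k = 0"
      unfolding P_def using that monic
      by (auto simp: coeff_map_poly coeff_eq_0 D_def)
  qed
  have dq: "degree q \<le> D"
    unfolding q_def D_def by (rule degree_map_poly_le)
  \<comment> \<open>The recursion multiplied by \<open>q ^ m\<close>: in the \<open>i\<close>-th
    summand \<open>q ^ (m - i + 1)\<close> cancels the denominator given by the induction
    hypothesis, and \<open>q ^ (i - 1)\<close> is left.\<close>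
  define R where "R = smult (of_nat (m + 1)) (P (m + 1) * q ^ m) - (\<Sum>i=1..m. P i * q ^ (i - 1) * N (m - i))"
  have pw: "degree (q ^ k) \<le> D * k" for k
    using degree_power_le[of q k] dq by (metis le_trans mult.commute mult_le_mono2)
  have "degree (P (m + 1) * q ^ m) \<le> (D - 1) + D * m"
    using degree_mult_le[of "P (m + 1)" "q ^ m"] dP[of "m + 1"] pw[of m] by simp
  then have d1: "degree (smult (of_nat (m + 1)) (P (m + 1) * q ^ m)) \<le> (m + 1) * D - 1"
    using deg degree_smult_le[of "of_nat (m + 1)" "P (m + 1) * q ^ m"]
    by (simp add: D_def algebra_simps)
  have d2: "degree (P i * q ^ (i - 1) * N (m - i)) \<le> (m + 1) * D - 1" if i: "i \<in> {1..m}" for i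
  proof -
    have "degree (P i * q ^ (i - 1) * N (m - i)) \<le> (D - 1) + D * (i - 1) + ((m - i + 1) * D - 1)"
    proof -
      have "degree (N (m - i)) < (m - i + 1) * D" "degree (P i) \<le> D - 1"
        using dP[of i] N(1)[of "m - i"] i by (auto simp: D_def)
      with degree_mult_le[of "P i * q ^ (i - 1)" "N (m - i)"] degree_mult_le[of "P i" "q ^ (i - 1)"]
        pw[of "i - 1"] show ?thesis by linarith
    qed
    also have "\<dots> \<le> D * 1 + D * (i - 1) + D * (m - i + 1) - 1"
      using deg by (simp add: D_def algebra_simps)
    also have "\<dots> = D * (1 + (i - 1) + (m - i + 1)) - 1"
      by (simp only: distrib_left)
    also have "1 + (i - 1) + (m - i + 1) = m + 1"
      using i by auto
    finally show ?thesis by (simp add: mult.commute)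
  qed
  have "degree R \<le> (m + 1) * D - 1"
    unfolding R_def by (intro degree_diff_le d1 degree_sum_le d2) auto
  then have 1: "degree R < (m + 1) * degree Q"
    using deg unfolding D_def by (metis One_nat_def Suc_pred add_gr_0 le_imp_less_Suc less_one mult_pos_pos)
  have 2: "dlog (poly Q (fps_const x)) $ m = poly R x / poly q x ^ (m + 1)" if x: "poly q x \<noteq> 0" for x
  proof -
    let ?s = "poly Q (fps_const x)"
    let ?z = "poly q x"
    have s0: "?s $ 0 = ?z" by (simp add: P q)
    have term_eq: "?z ^ m * (?s $ i * dlog ?s $ (m - i)) = poly (P i * q ^ (i - 1) * N (m - i)) x"
      if i: "i \<in> {1..m}" for i
    proof -
      have "m - i < m" and e: "m = (i - 1) + (m - i + 1)" using i by auto
      have "?z ^ m = ?z ^ (i - 1) * ?z ^ (m - i + 1)"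
        by (subst e) (rule power_add)
      then show ?thesis
        using x N(2)[OF \<open>m - i < m\<close> x] by (simp add: P field_simps)
    qed
    have "?z ^ (m + 1) * dlog ?s $ m = ?z ^ m * (?s $ 0 * dlog ?s $ m)"
      by (simp add: s0)
    also have "\<dots> = ?z ^ m * (of_nat (m + 1) * ?s $ (m + 1)) - (\<Sum>i=1..m. ?z ^ m * (?s $ i * dlog ?s $ (m - i)))"
      by (subst fps_nth_mult_dlog) (use x s0 in \<open>simp_all add: right_diff_distrib sum_distrib_left\<close>)
    also have "(\<Sum>i=1..m. ?z ^ m * (?s $ i * dlog ?s $ (m - i))) = (\<Sum>i=1..m. poly (P i * q ^ (i - 1) * N (m - i)) x)"
      by (intro sum.cong refl term_eq)
    also have "?z ^ m * (of_nat (m + 1) * ?s $ (m + 1)) = poly (smult (of_nat (m + 1)) (P (m + 1) * q ^ m)) x"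
      by (simp add: P algebra_simps)
    also have "\<dots> - (\<Sum>i=1..m. poly (P i * q ^ (i - 1) * N (m - i)) x) = poly R x"
      by (simp add: R_def poly_sum)
    finally show ?thesis
      using x by (simp add: field_simps)
  qed
  show ?case
    using 1 2 by blast
qed

text \<open>Uniqueness of partial fractions with denominators \<open>q i ^ M\<close>, in cleared
  form. All other summands are multiples of \<open>q i ^ M\<close>, so by coprimality it divides
  \<open>n i\<close>, whose degree is too small unless it is zero.\<close>

lemma partial_fraction_unique:
  fixes q n :: "'i \<Rightarrow> 'a::field_gcd poly"
  assumes "finite I"
    and cop: "\<And>i j. i \<in> I \<Longrightarrow> j \<in> I \<Longrightarrow> i \<noteq> j \<Longrightarrow> coprime (q i) (q j)"
    and q0: "\<And>i. i \<in> I \<Longrightarrow> q i \<noteq> 0"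
    and deg: "\<And>i. i \<in> I \<Longrightarrow> degree (n i) < M * degree (q i)"
    and zero: "(\<Sum>i\<in>I. n i * (\<Prod>j\<in>I - {i}. q j ^ M)) = 0"
    and i: "i \<in> I"
  shows "n i = 0"
proof (rule ccontr)
  assume nz: "n i \<noteq> 0"
  have h: "(\<Sum>k\<in>I - {i}. n k * (\<Prod>j\<in>I - {k}. q j ^ M)) + n i * (\<Prod>j\<in>I - {i}. q j ^ M) = 0"
    using zero sum.remove[OF \<open>finite I\<close> i, of "\<lambda>i. n i * (\<Prod>j\<in>I - {i}. q j ^ M)"] by (simp add: add.commute)
  have *: "q i ^ M dvd (\<Sum>k\<in>I - {i}. n k * (\<Prod>j\<in>I - {k}. q j ^ M))"
    using \<open>finite I\<close> i by (intro dvd_sum dvd_mult dvd_prodI) auto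
  have "q i ^ M dvd n i * (\<Prod>j\<in>I - {i}. q j ^ M)"
    by (rule dvd_add_right_iff[OF *, THEN iffD1]) (simp only: h dvd_0_right)
  moreover have "coprime (q i ^ M) (\<Prod>j\<in>I - {i}. q j ^ M)"
  proof (rule prod_coprime_right)
    fix j assume "j \<in> I - {i}"
    then have "coprime (q i) (q j)"
      using i by (intro cop) auto
    then show "coprime (q i ^ M) (q j ^ M)"
      by simp
  qed
  ultimately have "q i ^ M dvd n i"
    by (simp add: coprime_dvd_mult_left_iff)
  then have "degree (q i ^ M) \<le> degree (n i)"
    using nz by (rule dvd_imp_degree_le)
  then show False
    using deg[OF i] q0[OF i] by (simp add: degree_power_eq mult.commute)
qed

text \<open>\<open>'k\<close> is a vector space over \<open>'a\<close> via \<open>emb\<close>. A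
  vector outside the span of the finitely many \<open>W \<beta>\<close> can be separated from it by
  a linear functional.\<close>

lemma finite_span_if_annihilators:
  fixes emb :: "'a::field \<Rightarrow> 'k::field" and W :: "'b \<Rightarrow> 'k"
  assumes "field_hom emb" and fin: "finite B"
    and ann: "\<And>\<mu>. \<lbrakk>\<And>x y. \<mu> (x + y) = \<mu> x + \<mu> y; \<And>c x. \<mu> (emb c * x) = c * \<mu> x;
      \<And>\<beta>. \<beta> \<in> B \<Longrightarrow> \<mu> (W \<beta>) = 0\<rbrakk> \<Longrightarrow> \<mu> v = (0::'a)"
  shows "\<exists>w. v = (\<Sum>\<beta>\<in>B. emb (w \<beta>) * W \<beta>)"
proof (rule ccontr)
  assume contr: "\<nexists>w. v = (\<Sum>\<beta>\<in>B. emb (w \<beta>) * W \<beta>)"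
  interpret emb: field_hom emb by fact
  interpret V: vector_space "\<lambda>c x. emb c * x"
    by unfold_locales (simp_all add: algebra_simps emb.hom_add emb.hom_mult)
  interpret F: vector_space "(*) :: 'a \<Rightarrow> 'a \<Rightarrow> 'a"
    by unfold_locales (simp_all add: algebra_simps)
  interpret VF: vector_space_pair "\<lambda>c x. emb c * x" "(*) :: 'a \<Rightarrow> 'a \<Rightarrow> 'a"
    by unfold_locales
  define S where "S = range (\<lambda>w. \<Sum>\<beta>\<in>B. emb (w \<beta>) * W \<beta>)"
  have "V.subspace S"
    unfolding V.subspace_def
  proof (intro conjI ballI allI)
    show "0 \<in> S"
      unfolding S_def by (rule image_eqI[where x = "\<lambda>_. 0"]) auto
    fix x y c assume "x \<in> S"
    then obtain l where l: "x = (\<Sum>\<beta>\<in>B. emb (l \<beta>) * W \<beta>)" by (auto simp: S_def)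
    show "emb c * x \<in> S"
      unfolding S_def
      by (rule image_eqI[where x = "\<lambda>\<beta>. c * l \<beta>"]) (simp_all only: l emb.hom_mult sum_distrib_left mult.assoc UNIV_I)
    assume "y \<in> S"
    then obtain l' where l': "y = (\<Sum>\<beta>\<in>B. emb (l' \<beta>) * W \<beta>)" by (auto simp: S_def)
    show "x + y \<in> S"
      unfolding S_def
      by (rule image_eqI[where x = "\<lambda>\<beta>. l \<beta> + l' \<beta>"]) (simp_all only: l l' emb.hom_add sum.distrib distrib_right UNIV_I)
  qed
  moreover have "W ` B \<subseteq> S"
  proof
    fix x assume "x \<in> W ` B"
    then obtain b where b: "b \<in> B" "x = W b" by auto
    have "(\<Sum>\<beta>\<in>B. emb (if \<beta> = b then 1 else 0) * W \<beta>) = (\<Sum>\<beta>\<in>B. if \<beta> = b then W \<beta> else 0)"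
      by (intro sum.cong) auto
    then show "x \<in> S"
      unfolding S_def using b fin
      by (intro image_eqI[where x = "\<lambda>\<beta>. if \<beta> = b then 1 else 0"]) auto
  qed
  ultimately have "V.span (W ` B) \<subseteq> S"
    by (rule V.span_minimal[rotated])
  moreover have "v \<notin> S"
    using contr by (auto simp: S_def)
  ultimately have v: "v \<notin> V.span (W ` B)"
    by blast
  \<comment> \<open>The vectors \<open>W \<beta>\<close> may be dependent or coincide. A functional
    can be prescribed only on an independent set, here a basis of the span together with
    \<open>v\<close>.\<close>
  obtain C where C: "C \<subseteq> W ` B" "V.independent C" "W ` B \<subseteq> V.span C"
    using V.maximal_independent_subset by blast
  have "v \<notin> V.span C"
    using v C(1) V.span_mono by blast
  then have "V.independent (insert v C)"
    using C(2) V.independent_insertI by blast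
  from VF.linear_independent_extend[OF this, of "\<lambda>x. if x = v then 1 else 0"]
  obtain \<mu> where \<mu>: "Vector_Spaces.linear (\<lambda>c x. emb c * x) (*) \<mu>"
    and \<mu>v: "\<forall>x\<in>insert v C. \<mu> x = (if x = v then 1 else 0)"
    by blast
  interpret \<mu>: Vector_Spaces.linear "\<lambda>c x. emb c * x" "(*) :: 'a \<Rightarrow> 'a \<Rightarrow> 'a" \<mu> by fact
  have "v \<notin> C"
    using \<open>v \<notin> V.span C\<close> V.span_base by blast
  have \<mu>_0: "\<mu> x = 0" if "x \<in> V.span C" for x
  proof (rule \<mu>.eq_0_on_span[OF _ that])
    show "\<mu> y = 0" if "y \<in> C" for y
      using \<mu>v \<open>v \<notin> C\<close> that by auto
  qed
  have "\<mu> v = 0"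
  proof (rule ann)
    show "\<mu> (W \<beta>) = 0" if "\<beta> \<in> B" for \<beta>
      using C(3) that by (intro \<mu>_0) auto
  qed (simp_all only: \<mu>.add \<mu>.scale)
  then show False
    using \<mu>v by simp
qed

text \<open>Meant for a map that is linear over the scalars only: the coefficients of
  \<open>p\<close> are arbitrary, but powers of a scalar \<open>z\<close> can be pulled out of
  \<nu>.\<close>

lemma poly_map_poly_additive:
  fixes \<nu> :: "'k::comm_ring_1 \<Rightarrow> 'k"
  assumes add: "\<And>x y. \<nu> (x + y) = \<nu> x + \<nu> y" and scale: "\<And>x. \<nu> (z * x) = z * \<nu> x"
  shows "poly (map_poly \<nu> p) z = \<nu> (poly p z)"
proof -
  have "\<nu> 0 = 0"
    using add[of 0 0] by simp
  then show ?thesis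
    by (induction p) (simp_all add: map_poly_pCons add scale)
qed

text \<open>By duality it suffices that a linear functional vanishing on the right-hand sides for all \<open>\<beta> \<in> B\<close> vanishes on
  the left-hand side. Applied to the coefficients in \<open>y\<close>, it yields a vanishing sum of proper fractions with coprime
  denominators, so it annihilates every summand separately.\<close>
theorem dlog_linear_combination:
  fixes emb :: "'a::field \<Rightarrow> 'k::field_gcd" and Q :: "'i \<Rightarrow> 'k fps poly" and r :: "'i \<Rightarrow> 'a poly"
  assumes emb: "field_hom emb" and "finite I" and "finite B"
    and monic: "\<And>i. i \<in> I \<Longrightarrow> lead_coeff (Q i) = 1"
    and deg: "\<And>i. i \<in> I \<Longrightarrow> degree (Q i) > 0"
    and r: "\<And>i. i \<in> I \<Longrightarrow> map_poly (\<lambda>s. s $ 0) (Q i) = map_poly emb (r i)"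
    and cop: "\<And>i j. i \<in> I \<Longrightarrow> j \<in> I \<Longrightarrow> i \<noteq> j \<Longrightarrow> coprime (map_poly emb (r i)) (map_poly emb (r j))"
    and e: "\<And>i. i \<in> I \<Longrightarrow> (of_nat (e i) :: 'k) \<noteq> 0"
    and rB: "\<And>i \<beta>. i \<in> I \<Longrightarrow> \<beta> \<in> insert \<beta>\<^sub>0 B \<Longrightarrow> poly (r i) \<beta> \<noteq> 0"
    and card: "card B \<ge> (m + 1) * (\<Sum>i\<in>I. degree (Q i))"
  shows "\<exists>w. (\<Sum>i\<in>I. of_nat (a i) * dlog (poly (Q i) (fps_const (emb \<beta>\<^sub>0))) $ m) =
    (\<Sum>\<beta>\<in>B. emb (w \<beta>) * (\<Sum>i\<in>I. of_nat (e i) * dlog (poly (Q i) (fps_const (emb \<beta>))) $ m))"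
proof (rule finite_span_if_annihilators[OF emb \<open>finite B\<close>])
  interpret emb: field_hom emb by fact
  define q where "q i = map_poly emb (r i)" for i
  have "\<forall>i\<in>I. \<exists>N. degree N < (m + 1) * degree (Q i) \<and>
    (\<forall>x. poly (q i) x \<noteq> 0 \<longrightarrow> dlog (poly (Q i) (fps_const x)) $ m = poly N x / poly (q i) x ^ (m + 1))"
  proof
    fix i assume i: "i \<in> I"
    show "\<exists>N. degree N < (m + 1) * degree (Q i) \<and>
      (\<forall>x. poly (q i) x \<noteq> 0 \<longrightarrow> dlog (poly (Q i) (fps_const x)) $ m = poly N x / poly (q i) x ^ (m + 1))"
      using dlog_nth_strictly_proper[OF monic[OF i] deg[OF i], of m] by (simp only: q_def r[OF i])
  qed
  then obtain N where N: "\<And>i. i \<in> I \<Longrightarrow> degree (N i) < (m + 1) * degree (Q i)"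
    "\<And>i x. i \<in> I \<Longrightarrow> poly (q i) x \<noteq> 0 \<Longrightarrow>
      dlog (poly (Q i) (fps_const x)) $ m = poly (N i) x / poly (q i) x ^ (m + 1)"
    by metis
  have dq: "degree (q i) = degree (Q i)" and q0: "q i \<noteq> 0" if "i \<in> I" for i
  proof -
    have "coeff (q i) (degree (Q i)) = 1"
      using monic[OF that] by (simp add: q_def r[OF that, symmetric] coeff_map_poly)
    moreover have "degree (q i) \<le> degree (Q i)"
      unfolding q_def r[OF that, symmetric] by (rule degree_map_poly_le)
    ultimately show "degree (q i) = degree (Q i)" "q i \<noteq> 0"
      by (auto intro!: le_antisym le_degree)
  qed
  have pq: "poly (q i) (emb \<beta>) = emb (poly (r i) \<beta>)" for i \<beta>
    by (simp add: q_def)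
  have pq0: "poly (q i) (emb \<beta>) \<noteq> 0" if "i \<in> I" "\<beta> \<in> insert \<beta>\<^sub>0 B" for i \<beta>
    using rB[OF that] by (simp add: pq)

  fix \<mu> :: "'k \<Rightarrow> 'a"
  assume \<mu>_add: "\<And>x y. \<mu> (x + y) = \<mu> x + \<mu> y" and \<mu>_scale: "\<And>c x. \<mu> (emb c * x) = c * \<mu> x"
    and \<mu>_B: "\<And>\<beta>. \<beta> \<in> B \<Longrightarrow> \<mu> (\<Sum>i\<in>I. of_nat (e i) * dlog (poly (Q i) (fps_const (emb \<beta>))) $ m) = 0"
  \<comment> \<open>Embedding the values of \<mu> back into \<open>'k\<close> keeps the new
    numerators over the field of the denominators \<open>q i\<close>, so that divisibility arguments
    apply to them.\<close>
  define \<nu> where "\<nu> x = emb (\<mu> x)" for x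
  have \<nu>_add: "\<nu> (x + y) = \<nu> x + \<nu> y" for x y
    by (simp add: \<nu>_def \<mu>_add emb.hom_add)
  have \<nu>_scale: "\<nu> (emb c * x) = emb c * \<nu> x" for c x
    by (simp add: \<nu>_def \<mu>_scale emb.hom_mult)
  have \<nu>_0: "\<nu> 0 = 0"
    using \<nu>_scale[of 0 0] by simp
  have \<nu>_sum: "\<nu> (sum h A) = (\<Sum>x\<in>A. \<nu> (h x))" for h :: "'i \<Rightarrow> 'k" and A
    by (induction A rule: infinite_finite_induct) (simp_all add: \<nu>_0 \<nu>_add)
  have \<nu>_nat: "\<nu> (of_nat k * x) = of_nat k * \<nu> x" for k x
    using \<nu>_scale[of "of_nat k" x] by (simp add: emb.hom_of_nat)
  define n where "n i = map_poly \<nu> (N i)" for i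
  have \<nu>_dlog: "\<nu> (dlog (poly (Q i) (fps_const (emb \<beta>))) $ m) = poly (n i) (emb \<beta>) / poly (q i) (emb \<beta>) ^ (m + 1)"
    if "i \<in> I" "\<beta> \<in> insert \<beta>\<^sub>0 B" for i \<beta>
  proof -
    \<comment> \<open>At a scalar \<beta> the denominator is the image of a scalar, so \<nu> passes
      through it and acts on the numerator alone.\<close>
    have "\<nu> (dlog (poly (Q i) (fps_const (emb \<beta>))) $ m) = \<nu> (emb (1 / poly (r i) \<beta> ^ (m + 1)) * poly (N i) (emb \<beta>))"
      using N(2)[OF that(1) pq0[OF that]] by (simp add: pq emb.hom_div emb.hom_mult emb.hom_power)
    also have "\<dots> = emb (1 / poly (r i) \<beta> ^ (m + 1)) * poly (n i) (emb \<beta>)"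
      unfolding \<nu>_scale n_def by (subst poly_map_poly_additive) (simp_all add: \<nu>_add \<nu>_scale)
    finally show ?thesis
      by (simp add: pq emb.hom_div emb.hom_mult emb.hom_power)
  qed
  \<comment> \<open>The numerator of the weighted sum of fractions over the common denominator.
    Properness bounds its degree strictly below the number of its zeros, which include the image of
    \<open>B\<close>.\<close>
  define T where "T = (\<Sum>i\<in>I. smult (of_nat (e i)) (n i) * (\<Prod>j\<in>I - {i}. q j ^ (m + 1)))"
  have "poly T (emb \<beta>) = 0" if \<beta>: "\<beta> \<in> B" for \<beta>
  proof -
    have "0 = \<nu> (\<Sum>i\<in>I. of_nat (e i) * dlog (poly (Q i) (fps_const (emb \<beta>))) $ m)"
      using \<mu>_B[OF \<beta>] by (simp add: \<nu>_def)
    also have "\<dots> = (\<Sum>i\<in>I. of_nat (e i) * (poly (n i) (emb \<beta>) / poly (q i) (emb \<beta>) ^ (m + 1)))"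
      using \<beta> by (simp add: \<nu>_sum \<nu>_nat \<nu>_dlog)
    finally have "0 = (\<Prod>j\<in>I. poly (q j) (emb \<beta>) ^ (m + 1)) *
        (\<Sum>i\<in>I. of_nat (e i) * (poly (n i) (emb \<beta>) / poly (q i) (emb \<beta>) ^ (m + 1)))"
      by simp
    also have "\<dots> = (\<Sum>i\<in>I. of_nat (e i) * poly (n i) (emb \<beta>) * (\<Prod>j\<in>I - {i}. poly (q j) (emb \<beta>) ^ (m + 1)))"
      unfolding sum_distrib_left
    proof (intro sum.cong refl)
      fix i assume i: "i \<in> I"
      show "(\<Prod>j\<in>I. poly (q j) (emb \<beta>) ^ (m + 1)) * (of_nat (e i) * (poly (n i) (emb \<beta>) / poly (q i) (emb \<beta>) ^ (m + 1)))
        = of_nat (e i) * poly (n i) (emb \<beta>) * (\<Prod>j\<in>I - {i}. poly (q j) (emb \<beta>) ^ (m + 1))"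
        using pq0[OF i, of \<beta>] \<beta> by (subst prod.remove[OF \<open>finite I\<close> i]) simp
    qed
    also have "\<dots> = poly T (emb \<beta>)"
      by (simp add: T_def poly_sum poly_prod mult.assoc)
    finally show ?thesis by simp
  qed
  then have sub: "emb ` B \<subseteq> {x. poly T x = 0}"
    by auto
  have n_deg: "degree (n i) < (m + 1) * degree (q i)" if "i \<in> I" for i
    using N(1)[OF that] degree_map_poly_le[of \<nu> "N i"] dq[OF that] by (simp add: n_def)
  have "T = 0"
  proof (cases "I = {}")
    case False
    have "degree T < (m + 1) * (\<Sum>i\<in>I. degree (q i))"
      unfolding T_def
    proof (rule degree_sum_less)
      show "0 < (m + 1) * (\<Sum>i\<in>I. degree (q i))"
        using False \<open>finite I\<close> deg dq by (auto simp: sum_pos)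
      fix i assume i: "i \<in> I"
      have "degree (\<Prod>j\<in>I - {i}. q j ^ (m + 1)) = (\<Sum>j\<in>I - {i}. (m + 1) * degree (q j))"
        by (subst degree_prod_eq_sum_degree) (use q0 in \<open>auto intro!: sum.cong simp: degree_power_eq simp del: power_Suc\<close>)
      moreover have "degree (smult (of_nat (e i)) (n i)) < (m + 1) * degree (q i)"
        using n_deg[OF i] degree_smult_le le_less_trans by blast
      ultimately have "degree (smult (of_nat (e i)) (n i) * (\<Prod>j\<in>I - {i}. q j ^ (m + 1))) <
          (m + 1) * degree (q i) + (\<Sum>j\<in>I - {i}. (m + 1) * degree (q j))"
        using degree_mult_le[of "smult (of_nat (e i)) (n i)" "\<Prod>j\<in>I - {i}. q j ^ (m + 1)"] by linarith
      also have "\<dots> = (m + 1) * (\<Sum>i\<in>I. degree (q i))"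
        unfolding sum_distrib_left by (rule sum.remove[OF \<open>finite I\<close> i, symmetric])
      finally show "degree (smult (of_nat (e i)) (n i) * (\<Prod>j\<in>I - {i}. q j ^ (m + 1))) < (m + 1) * (\<Sum>i\<in>I. degree (q i))" .
    qed
    also have "\<dots> \<le> card (emb ` B)"
      using card dq by (simp add: card_image[OF emb.inj_f[THEN inj_on_subset]] inj_on_def)
    finally have *: "degree T < card (emb ` B)" .
    show ?thesis
    proof (rule ccontr)
      assume "T \<noteq> 0"
      then have "card (emb ` B) \<le> card {x. poly T x = 0}" "card {x. poly T x = 0} \<le> degree T"
        using sub by (auto intro!: card_mono poly_roots_finite card_poly_roots_bound)
      with * show False by simp
    qed
  qed (simp add: T_def)
  have n0: "n i = 0" if i: "i \<in> I" for i
  proof -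
    have "smult (of_nat (e i)) (n i) = 0"
    proof (rule partial_fraction_unique[OF \<open>finite I\<close>, where q = q and M = "m + 1"])
      show "(\<Sum>i\<in>I. smult (of_nat (e i)) (n i) * (\<Prod>j\<in>I - {i}. q j ^ (m + 1))) = 0"
        using \<open>T = 0\<close> by (simp add: T_def)
      show "degree (smult (of_nat (e i)) (n i)) < (m + 1) * degree (q i)" if "i \<in> I" for i
        using n_deg[OF that] degree_smult_le le_less_trans by blast
    qed (use cop q0 i in \<open>auto simp: q_def\<close>)
    then show ?thesis using e[OF i] by simp
  qed
  \<comment> \<open>The numerators vanish as polynomials, so every summand is annihilated at the new
    point \<open>\<beta>\<^sub>0\<close> as well, whatever the weights \<open>a i\<close>.\<close>
  have "\<nu> (\<Sum>i\<in>I. of_nat (a i) * dlog (poly (Q i) (fps_const (emb \<beta>\<^sub>0))) $ m) = 0"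
    by (simp add: \<nu>_sum \<nu>_nat \<nu>_dlog n0)
  then show "\<mu> (\<Sum>i\<in>I. of_nat (a i) * dlog (poly (Q i) (fps_const (emb \<beta>\<^sub>0))) $ m) = 0"
    by (simp add: \<nu>_def)
qed

section \<open>Coprime factorization and specialization\<close>

text \<open>One denominator for a whole finite set, so that a single nonvanishing condition allows
  all these polynomials to be specialized at a point.\<close>

lemma ex_common_denominator:
  fixes P :: "'r::idom fract poly set"
  assumes "finite P"
  shows "\<exists>D. D \<noteq> 0 \<and> (\<forall>p\<in>P. \<exists>q. map_poly to_fract q = smult (to_fract D) p)"
  using assms
proof (induction P)
  case empty
  show ?case by (intro exI[of _ 1]) simp
next
  case (insert p P)
  have "\<exists>D. D \<noteq> 0 \<and> (\<exists>q. map_poly to_fract q = smult (to_fract D) p)"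
  proof (induction p)
    case 0
    show ?case by (intro exI[of _ 1] conjI exI[of _ 0]) simp_all
  next
    case (pCons c p)
    then obtain D q where D: "D \<noteq> 0" "map_poly to_fract q = smult (to_fract D) p"
      by auto
    obtain a b where c: "c = Fract a b" "b \<noteq> 0"
      by (cases c) auto
    have "map_poly to_fract (pCons (D * a) (smult b q)) = smult (to_fract (D * b)) (pCons c p)"
      using c D by (simp add: to_fract_hom.map_poly_pCons_hom to_fract_hom.map_poly_hom_smult Fract_conv_to_fract mult.commute)
    then show ?case
      using c D by (intro exI[of _ "D * b"]) auto
  qed
  then obtain D\<^sub>1 q where D1: "D\<^sub>1 \<noteq> 0" "map_poly to_fract q = smult (to_fract D\<^sub>1) p"
    by auto
  obtain D\<^sub>2 where D2: "D\<^sub>2 \<noteq> 0" "\<forall>p\<in>P. \<exists>q. map_poly to_fract q = smult (to_fract D\<^sub>2) p"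
    using insert.IH by auto
  have "\<exists>q. map_poly to_fract q = smult (to_fract (D\<^sub>1 * D\<^sub>2)) p'" if p': "p' \<in> insert p P" for p'
  proof (cases "p' = p")
    case True
    have "map_poly to_fract (smult D\<^sub>2 q) = smult (to_fract (D\<^sub>1 * D\<^sub>2)) p'"
      using D1 True by (simp add: mult.commute)
    then show ?thesis by blast
  next
    case False
    then obtain q' where "map_poly to_fract q' = smult (to_fract D\<^sub>2) p'"
      using D2 p' by auto
    then have "map_poly to_fract (smult D\<^sub>1 q') = smult (to_fract (D\<^sub>1 * D\<^sub>2)) p'"
      by simp
    then show ?thesis by blast
  qed
  then show ?case
    using D1 D2 by (intro exI[of _ "D\<^sub>1 * D\<^sub>2"]) auto
qed

lemma unit_factor_field_poly:
  fixes F :: "'k::field_gcd poly"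
  assumes "F \<noteq> 0"
  shows "unit_factor F = [:lead_coeff F:]"
  using assms by (simp add: unit_factor_poly_def is_unit_unit_factor dvd_field_iff)

text \<open>\<open>I\<close> may exceed the prime factors of \<open>F\<close>; surplus primes get
  exponent zero. In this way a divisor is written over the primes of the polynomial that it
  divides.\<close>

lemma poly_eq_smult_prod_prime_powers:
  fixes F :: "'k::field_gcd poly"
  assumes "F \<noteq> 0" "finite I" "prime_factors F \<subseteq> I" "\<And>p. p \<in> I \<Longrightarrow> prime p"
  shows "F = smult (lead_coeff F) (\<Prod>p\<in>I. p ^ multiplicity p F)"
proof -
  have "(\<Prod>p\<in>I. p ^ multiplicity p F) = (\<Prod>p\<in>prime_factors F. p ^ multiplicity p F)"
  proof (rule prod.mono_neutral_right[OF assms(2,3)], rule ballI)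
    fix p assume "p \<in> I - prime_factors F"
    then have "multiplicity p F = 0"
      using assms(1,4) by (auto simp: prime_factors_multiplicity)
    then show "p ^ multiplicity p F = 1" by simp
  qed
  also have "\<dots> = normalize F"
    by (rule prod_prime_factors) fact
  also have "smult (lead_coeff F) \<dots> = F"
    using unit_factor_mult_normalize[of F] by (simp add: unit_factor_field_poly[OF assms(1)])
  finally show ?thesis by simp
qed

text \<open>The factorization over the fraction field, with the denominators (also those of the Bezout coefficients) cleared
  by \<open>D\<close>: it can be specialized at every point where \<open>D\<close> does not vanish.\<close>
lemma simultaneous_coprime_factorization:
  fixes f g :: "'r::idom poly"
  assumes "f \<noteq> 0" "g dvd f"
  obtains I :: "'r fract poly set" and q D e a where
    "finite I" "D \<noteq> 0"
    "\<And>i. i \<in> I \<Longrightarrow> e i > (0::nat)" "\<And>i. i \<in> I \<Longrightarrow> degree (q i) > 0" "\<And>i. i \<in> I \<Longrightarrow> lead_coeff (q i) = D"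
    "\<And>i j. i \<in> I \<Longrightarrow> j \<in> I \<Longrightarrow> i \<noteq> j \<Longrightarrow> \<exists>A B. A * q i + B * q j = [:D ^ 2:]"
    "smult (D ^ sum e I) f = smult (lead_coeff f) (\<Prod>i\<in>I. q i ^ e i)"
    "smult (D ^ sum a I) g = smult (lead_coeff g) (\<Prod>i\<in>I. q i ^ a i)"
proof -
  interpret mf: map_poly_inj_idom_hom "to_fract :: 'r \<Rightarrow> 'r fract" ..
  let ?m = "map_poly to_fract :: 'r poly \<Rightarrow> 'r fract poly"
  define I where "I = prime_factors (?m f)"
  have "g \<noteq> 0" using assms by auto
  have f0: "?m f \<noteq> 0" and g0: "?m g \<noteq> 0" and dvd: "?m g dvd ?m f"
    using assms \<open>g \<noteq> 0\<close> by auto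
  have fin: "finite I" and pr: "\<And>p. p \<in> I \<Longrightarrow> prime p" and sub: "prime_factors (?m g) \<subseteq> I"
    using dvd_prime_factors[OF f0 dvd] by (auto simp: I_def)
  define e where "e p = multiplicity p (?m f)" for p
  define a where "a p = multiplicity p (?m g)" for p
  have e: "e p > 0" if "p \<in> I" for p
    using that by (auto simp: e_def I_def prime_factors_multiplicity)
  have monic: "lead_coeff p = 1" and degp: "degree p > 0" if "p \<in> I" for p
  proof -
    have "prime p" using pr that .
    then have "p \<noteq> 0" "normalize p = p" by (auto simp: normalize_prime)
    then have "[:lead_coeff p:] = 1"
      using unit_factor_normalize[of p] unit_factor_field_poly[of p] by simp
    from arg_cong[OF this, of "\<lambda>q. coeff q 0"] show "lead_coeff p = 1"
      by simp
    have "\<not> p dvd 1"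
      using not_prime_unit[of p] \<open>prime p\<close> by blast
    with \<open>p \<noteq> 0\<close> have "degree p \<noteq> 0"
      using is_unit_iff_degree[of p] by blast
    then show "degree p > 0" by simp
  qed
  define bz where "bz p p' = bezout_coefficients p p'" for p p' :: "'r fract poly"
  have bz: "fst (bz p p') * p + snd (bz p p') * p' = 1" if "p \<in> I" "p' \<in> I" "p \<noteq> p'" for p p'
    using bezout_coefficients_fst_snd[of p p'] primes_coprime[OF pr pr, of p p'] that
    by (simp add: bz_def)
  let ?P = "I \<union> (\<lambda>(p, p'). fst (bz p p')) ` (I \<times> I) \<union> (\<lambda>(p, p'). snd (bz p p')) ` (I \<times> I)"
  have "finite ?P" using fin by auto
  then obtain D where D: "D \<noteq> 0" "\<forall>p\<in>?P. \<exists>q. ?m q = smult (to_fract D) p"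
    using ex_common_denominator[of ?P] by blast
  then obtain q where q: "\<And>p. p \<in> ?P \<Longrightarrow> ?m (q p) = smult (to_fract D) p"
    by metis
  have qI: "?m (q p) = smult (to_fract D) p" if "p \<in> I" for p
    using q that by auto
  have deg: "degree (q p) = degree p" if "p \<in> I" for p
    using arg_cong[OF qI[OF that], of degree] D(1) by simp
  have lc: "lead_coeff (q p) = D" if "p \<in> I" for p
    using arg_cong[OF qI[OF that], of lead_coeff] monic[OF that] D(1) by simp
  \<comment> \<open>One factor \<open>D\<close> comes from the Bezout coefficient and one from the
    prime, hence the square.\<close>
  have comax: "\<exists>A B. A * q i + B * q j = [:D ^ 2:]" if ij: "i \<in> I" "j \<in> I" "i \<noteq> j" for i j
  proof -
    have 1: "?m (q (fst (bz i j))) = smult (to_fract D) (fst (bz i j))"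
      and 2: "?m (q (snd (bz i j))) = smult (to_fract D) (snd (bz i j))"
      using ij by (auto intro!: q)
    have "?m (q (fst (bz i j)) * q i + q (snd (bz i j)) * q j)
        = smult (to_fract (D ^ 2)) (fst (bz i j) * i + snd (bz i j) * j)"
      by (simp add: hom_distribs 1 2 qI ij power2_eq_square smult_add_right)
    also have "\<dots> = ?m [:D ^ 2:]"
      by (simp add: bz ij to_fract_hom.map_poly_pCons_hom)
    finally have "q (fst (bz i j)) * q i + q (snd (bz i j)) * q j = [:D ^ 2:]"
      by (rule mf.injectivity)
    then show ?thesis by blast
  qed
  \<comment> \<open>Each monic prime, counted with multiplicity, brings one factor
    \<open>D\<close>.\<close>
  have fact: "smult (D ^ (\<Sum>p\<in>I. multiplicity p (?m h))) h = smult (lead_coeff h) (\<Prod>i\<in>I. q i ^ multiplicity i (?m h))"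
    if h: "h \<noteq> 0" "prime_factors (?m h) \<subseteq> I" for h
  proof -
    have "?m (\<Prod>i\<in>I. q i ^ multiplicity i (?m h)) = (\<Prod>i\<in>I. smult (to_fract D) i ^ multiplicity i (?m h))"
      by (simp add: hom_distribs qI)
    also have "\<dots> = smult (to_fract (D ^ (\<Sum>p\<in>I. multiplicity p (?m h)))) (\<Prod>i\<in>I. i ^ multiplicity i (?m h))"
      by (simp add: smult_power prod_smult power_sum hom_distribs)
    finally have "?m (smult (lead_coeff h) (\<Prod>i\<in>I. q i ^ multiplicity i (?m h)))
      = smult (to_fract (D ^ (\<Sum>p\<in>I. multiplicity p (?m h)))) (smult (lead_coeff (?m h)) (\<Prod>i\<in>I. i ^ multiplicity i (?m h)))"
      by (simp add: hom_distribs mult.commute)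
    also have "smult (lead_coeff (?m h)) (\<Prod>i\<in>I. i ^ multiplicity i (?m h)) = ?m h"
      by (rule poly_eq_smult_prod_prime_powers[symmetric]) (use h fin pr in auto)
    also have "smult (to_fract (D ^ (\<Sum>p\<in>I. multiplicity p (?m h)))) (?m h)
      = ?m (smult (D ^ (\<Sum>p\<in>I. multiplicity p (?m h))) h)"
      by (simp add: hom_distribs)
    finally show ?thesis
      by (rule mf.injectivity[symmetric])
  qed
  show ?thesis
    using fin D(1) e deg degp lc comax fact[OF \<open>f \<noteq> 0\<close>] fact[OF \<open>g \<noteq> 0\<close> sub]
    by (intro that[of I D e q a]) (auto simp: e_def[abs_def] a_def[abs_def] I_def)
qed

section \<open>Restrictions to lines over the fraction field\<close>

definition const_fract :: "'a::field \<Rightarrow> 'a mpoly fract" where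
  "const_fract c = to_fract (mp_const c)"

interpretation const_fract_hom: field_hom "const_fract :: 'a::field \<Rightarrow> 'a mpoly fract"
  by unfold_locales (simp_all add: const_fract_def hom_distribs)

text \<open>The restriction is kept in two forms: as a series, where it can be inverted and
  \<open>dlog\<close> makes sense, and as \<open>line_poly\<close>, where degrees and values at
  scalars are available.\<close>

definition line_series :: "(nat \<Rightarrow> 'a::field) \<Rightarrow> (nat \<Rightarrow> 'a) \<Rightarrow> 'a \<Rightarrow> 'a mpoly \<Rightarrow> 'a mpoly fract fps" where
  "line_series a b \<beta> = meval (\<lambda>c. fps_const (const_fract c))
     (\<lambda>i. fps_const (const_fract (a i + \<beta> * b i)) + fps_const (to_fract (mp_var i) - const_fract (a i)) * fps_X)"

lemma comm_ring_hom_fps_const_fract: "comm_ring_hom (\<lambda>c. fps_const (const_fract c))"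
  by unfold_locales (simp_all add: const_fract_hom.hom_add const_fract_hom.hom_mult)

lemma comm_ring_hom_line_series: "comm_ring_hom (line_series a b \<beta>)"
  unfolding line_series_def by (intro comm_ring_hom_meval comm_ring_hom_fps_const_fract)

text \<open>The constant term forgets the direction x - a and leaves an evaluation at a point with
  coordinates in \<open>'a\<close>. This is the source of all scalar denominators.\<close>

lemma line_series_nth_0:
  "line_series a b \<beta> p $ 0 = const_fract (meval (\<lambda>x. x) (\<lambda>i. a i + \<beta> * b i) p)"
proof -
  have "comm_ring_hom (\<lambda>s :: 'a mpoly fract fps. s $ 0)"
    by unfold_locales simp_all
  then show ?thesis
    unfolding line_series_def
    by (subst comm_ring_hom.hom_meval) (simp_all add: const_fract_hom.hom_meval)
qed

lemma comm_ring_hom_coeff_lift: "comm_ring_hom h \<Longrightarrow> comm_ring_hom (\<lambda>c. [:h c:])"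
proof -
  assume "comm_ring_hom h"
  then interpret comm_ring_hom h .
  show ?thesis by unfold_locales (simp_all add: hom_add hom_mult)
qed

definition line_poly :: "(nat \<Rightarrow> 'a::field) \<Rightarrow> (nat \<Rightarrow> 'a) \<Rightarrow> 'a \<Rightarrow> 'a mpoly \<Rightarrow> 'a mpoly fract poly" where
  "line_poly a b \<beta> = meval (\<lambda>c. [:const_fract c:])
    (\<lambda>i. [:const_fract (a i + \<beta> * b i), to_fract (mp_var i) - const_fract (a i):])"

lemma comm_ring_hom_const_poly: "comm_ring_hom (\<lambda>c. [:const_fract c:])"
  by (rule comm_ring_hom_coeff_lift) unfold_locales

lemma comm_ring_hom_line_poly: "comm_ring_hom (line_poly a b \<beta>)"
  unfolding line_poly_def by (rule comm_ring_hom_meval[OF comm_ring_hom_const_poly])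

lemma fps_of_line_poly: "fps_of_poly (line_poly a b \<beta> p) = line_series a b \<beta> p"
proof -
  have "comm_ring_hom (fps_of_poly :: 'a mpoly fract poly \<Rightarrow> _)"
    by unfold_locales (simp_all add: fps_of_poly_add fps_of_poly_mult)
  then show ?thesis
    unfolding line_series_def line_poly_def
    by (subst comm_ring_hom.hom_meval) (simp_all add: fps_of_poly_pCons)
qed

text \<open>Degrees add up in the product of the two line polynomials, so both are constant. It
  serves for the leading coefficient of a divisor of \<open>f\<close>, which divides a nonzero
  scalar and is then removed by \<open>dlog\<close>.\<close>

lemma line_series_const_if_mult_const:
  assumes "p * q = mp_const c" "c \<noteq> 0"
  shows "\<exists>k. k \<noteq> 0 \<and> line_series a b \<beta> p = fps_const k"
proof -
  interpret lp: comm_ring_hom "line_poly a b \<beta>"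
    by (rule comm_ring_hom_line_poly)
  have prod: "line_poly a b \<beta> p * line_poly a b \<beta> q = [:const_fract c:]"
    unfolding lp.hom_mult[symmetric] assms(1) by (simp add: line_poly_def comm_ring_hom.meval_const[OF comm_ring_hom_const_poly])
  then have nz: "line_poly a b \<beta> p \<noteq> 0" "line_poly a b \<beta> q \<noteq> 0"
    using assms(2) by auto
  have "degree (line_poly a b \<beta> p) + degree (line_poly a b \<beta> q) = 0"
    using degree_mult_eq[OF nz] prod by simp
  then obtain k where "line_poly a b \<beta> p = [:k:]"
    by (metis add_eq_0_iff_both_eq_0 degree_eq_zeroE)
  then show ?thesis
    using nz by (auto simp flip: fps_of_line_poly)
qed

text \<open>The point \<open>a\<close> and the direction \<open>b\<close> are fixed before
  \<open>B\<close> and \<open>m\<close>, so the same lines serve all coefficients of the logarithmic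
  derivative; only the weights vary with \<open>m\<close>.\<close>

theorem dlog_factor_linear_combination:
  fixes f g :: "'a::field mpoly"
  assumes char: "CHAR('a) = 0" and "f \<noteq> 0" "g dvd f"
  shows "\<exists>a b. meval (\<lambda>x. x) a f \<noteq> 0 \<and>
    (\<forall>B m. finite B \<longrightarrow> (\<forall>\<beta>\<in>B. meval (\<lambda>x. x) (\<lambda>i. a i + \<beta> * b i) f \<noteq> 0) \<longrightarrow>
      card B \<ge> (m + 1) * total_degree f \<longrightarrow>
      (\<exists>w. dlog (line_series a b 0 g) $ m = (\<Sum>\<beta>\<in>B. const_fract (w \<beta>) * dlog (line_series a b \<beta> f) $ m)))"
proof -
  let ?ev = "meval (\<lambda>x :: 'a. x)"
  note of_nat = of_nat_neq_0_if_char_0[OF char]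
  have inf: "infinite (UNIV :: 'a set)"
    by (rule infinite_UNIV_if_char_0[OF char])
  obtain b where b: "?ev b (top_part f) \<noteq> 0"
    using ex_meval_nonzero[OF top_part_nonzero[OF \<open>f \<noteq> 0\<close>] inf] by blast
  \<comment> \<open>\<open>\<Psi> p\<close> is p(x + y b), a polynomial in y over the multivariate
    polynomials. By the choice of \<open>b\<close> its leading coefficient for \<open>p = f\<close>
    is a nonzero scalar.\<close>
  define \<Psi> where "\<Psi> = meval (\<lambda>c. [:mp_const c :: 'a mpoly:]) (\<lambda>i. [:mp_var i, mp_const (b i):])"
  have lift: "comm_ring_hom (\<lambda>c. [:mp_const c :: 'a mpoly:])"
    by (rule comm_ring_hom_coeff_lift) unfold_locales
  interpret \<Psi>: comm_ring_hom \<Psi>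
    unfolding \<Psi>_def by (rule comm_ring_hom_meval[OF lift])
  define d where "d = total_degree f"
  define c\<^sub>0 where "c\<^sub>0 = ?ev b (top_part f)"
  have "coeff (\<Psi> f) d = mp_const c\<^sub>0"
    unfolding \<Psi>_def d_def c\<^sub>0_def
    by (rule coeff_meval_linear_total_degree) unfold_locales
  moreover have "degree (\<Psi> f) \<le> d"
    unfolding \<Psi>_def d_def by (rule degree_meval_linear)
  moreover have "mp_const c\<^sub>0 \<noteq> 0"
    using b by (simp add: c\<^sub>0_def)
  ultimately have deg\<Psi>: "degree (\<Psi> f) = d" and lc\<Psi>: "lead_coeff (\<Psi> f) = mp_const c\<^sub>0"
    by (metis le_antisym le_degree)+
  have "\<Psi> f \<noteq> 0"
    using lc\<Psi> \<open>mp_const c\<^sub>0 \<noteq> 0\<close> by auto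
  have dvd: "\<Psi> g dvd \<Psi> f"
    using \<open>g dvd f\<close> by (rule \<Psi>.hom_dvd)
  obtain I :: "'a mpoly fract poly set" and q D e k where fin: "finite I" and D: "D \<noteq> 0"
    and e: "\<And>i. i \<in> I \<Longrightarrow> e i > (0::nat)" and degq: "\<And>i. i \<in> I \<Longrightarrow> degree (q i) > 0"
    and lcq: "\<And>i. i \<in> I \<Longrightarrow> lead_coeff (q i) = D"
    and comax: "\<And>i j. i \<in> I \<Longrightarrow> j \<in> I \<Longrightarrow> i \<noteq> j \<Longrightarrow> \<exists>A B. A * q i + B * q j = [:D ^ 2:]"
    and fact_f: "smult (D ^ sum e I) (\<Psi> f) = smult (lead_coeff (\<Psi> f)) (\<Prod>i\<in>I. q i ^ e i)"
    and fact_g: "smult (D ^ sum k I) (\<Psi> g) = smult (lead_coeff (\<Psi> g)) (\<Prod>i\<in>I. q i ^ k i)"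
  proof (rule simultaneous_coprime_factorization[OF \<open>\<Psi> f \<noteq> 0\<close> dvd])
  qed (rule that)
  have q0: "q i \<noteq> 0" if "i \<in> I" for i
    using lcq[OF that] D by auto
  have "d = (\<Sum>i\<in>I. e i * degree (q i))"
  proof -
    have "d = degree (smult (D ^ sum e I) (\<Psi> f))"
      using D by (simp add: deg\<Psi>)
    also have "\<dots> = degree (\<Prod>i\<in>I. q i ^ e i)"
      unfolding fact_f using lc\<Psi> \<open>mp_const c\<^sub>0 \<noteq> 0\<close> by simp
    also have "\<dots> = (\<Sum>i\<in>I. e i * degree (q i))"
      using q0 by (subst degree_prod_eq_sum_degree) (auto simp: degree_power_eq intro!: sum.cong)
    finally show ?thesis .
  qed
  also have "\<dots> \<ge> (\<Sum>i\<in>I. degree (q i))"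
    using e by (intro sum_mono) (simp add: Suc_leI)
  finally have sum_deg: "(\<Sum>i\<in>I. degree (q i)) \<le> d" .
  \<comment> \<open>Genericity of \<open>a\<close>: the cleared factorization can be specialized at
    \<open>a\<close>, and \<open>f\<close> does not vanish at the start of the line for \<beta> =
    0.\<close>
  obtain a where a: "?ev a (f * D) \<noteq> 0"
    using ex_meval_nonzero[of "f * D"] \<open>f \<noteq> 0\<close> D inf by auto
  interpret ev: comm_ring_hom "?ev a"
    by (rule comm_ring_hom_meval[OF comm_ring_hom_id])
  have fa: "?ev a f \<noteq> 0" and Da: "?ev a D \<noteq> 0"
    using a by (auto simp: ev.hom_mult)

  \<comment> \<open>\<psi> replaces x by a + t (x - a). Applied to the coefficients of
    \<open>\<Psi> p\<close> and followed by y = \<beta> it yields every line of the family, so one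
    factorization serves all \<beta>.\<close>
  define \<psi> where "\<psi> = line_series a b 0"
  interpret \<psi>: comm_ring_hom \<psi>
    unfolding \<psi>_def by (rule comm_ring_hom_line_series)
  interpret m\<psi>: map_poly_comm_ring_hom \<psi> ..
  have \<psi>0: "\<psi> p $ 0 = const_fract (?ev a p)" for p
    by (simp add: \<psi>_def line_series_nth_0)
  have line: "poly (map_poly \<psi> (\<Psi> p)) (fps_const (const_fract \<beta>)) = line_series a b \<beta> p" for p \<beta>
  proof -
    have hom: "comm_ring_hom (\<lambda>P. poly (map_poly \<psi> P) (fps_const (const_fract \<beta>)))"
      by unfold_locales (simp_all add: hom_distribs)
    show ?thesis
      unfolding \<Psi>_def comm_ring_hom.hom_meval[OF hom] line_series_def
      by (simp add: \<psi>.map_poly_pCons_hom, simp add: \<psi>_def line_series_def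
          comm_ring_hom.meval_const[OF comm_ring_hom_fps_const_fract]
          comm_ring_hom.meval_var[OF comm_ring_hom_fps_const_fract]
          const_fract_hom.hom_add const_fract_hom.hom_mult add_ac flip: fps_const_add fps_const_mult)
  qed
  define u where "u = \<psi> D"
  have u0: "u $ 0 \<noteq> 0"
    using Da by (simp add: u_def \<psi>0)
  then have uinv: "u * inverse u = 1"
    by (rule inverse_mult_eq_1')
  have "u \<noteq> 0"
    using u0 by auto
  \<comment> \<open>The common leading coefficient \<open>u\<close> is a unit among the power series
    because its constant term is the value of \<open>D\<close> at \<open>a\<close>. Dividing by it
    makes the factors monic, as the properness argument demands.\<close>
  define Q where "Q i = smult (inverse u) (map_poly \<psi> (q i))" for i
  have uQ: "map_poly \<psi> (q i) = smult u (Q i)" for i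
    by (simp add: Q_def uinv)
  have lcQ: "lead_coeff (Q i) = 1" and degQ: "degree (Q i) = degree (q i)" if i: "i \<in> I" for i
  proof -
    have "coeff (map_poly \<psi> (q i)) (degree (q i)) = u"
      using lcq[OF i] by (simp add: u_def)
    then have "degree (map_poly \<psi> (q i)) = degree (q i)"
      using \<open>u \<noteq> 0\<close> degree_map_poly_le[of \<psi> "q i"] by (metis le_antisym le_degree)
    moreover have "inverse u \<noteq> 0"
      by (metis uinv mult_zero_right zero_neq_one)
    ultimately show *: "degree (Q i) = degree (q i)"
      by (simp add: Q_def)
    show "lead_coeff (Q i) = 1"
      unfolding * using lcq[OF i] uinv by (simp add: Q_def u_def mult.commute)
  qed
  have factor: "line_series a b \<beta> p = \<psi> (lead_coeff (\<Psi> p)) * (\<Prod>i\<in>I. poly (Q i) (fps_const (const_fract \<beta>)) ^ n i)"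
    if p: "smult (D ^ sum n I) (\<Psi> p) = smult (lead_coeff (\<Psi> p)) (\<Prod>i\<in>I. q i ^ n i)" for p n \<beta>
  proof -
    have "smult (u ^ sum n I) (map_poly \<psi> (\<Psi> p)) = map_poly \<psi> (smult (D ^ sum n I) (\<Psi> p))"
      by (simp add: hom_distribs u_def)
    also have "\<dots> = smult (\<psi> (lead_coeff (\<Psi> p))) (\<Prod>i\<in>I. map_poly \<psi> (q i) ^ n i)"
      unfolding p by (simp add: hom_distribs)
    also have "(\<Prod>i\<in>I. map_poly \<psi> (q i) ^ n i) = smult (u ^ sum n I) (\<Prod>i\<in>I. Q i ^ n i)"
      unfolding uQ by (simp add: smult_power prod_smult power_sum)
    also have "smult (\<psi> (lead_coeff (\<Psi> p))) \<dots> = smult (u ^ sum n I) (smult (\<psi> (lead_coeff (\<Psi> p))) (\<Prod>i\<in>I. Q i ^ n i))"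
      by (simp add: mult.commute)
    finally have "smult (u ^ sum n I) (map_poly \<psi> (\<Psi> p) - smult (\<psi> (lead_coeff (\<Psi> p))) (\<Prod>i\<in>I. Q i ^ n i)) = 0"
      by (simp only: smult_diff_right diff_self)
    then have "map_poly \<psi> (\<Psi> p) = smult (\<psi> (lead_coeff (\<Psi> p))) (\<Prod>i\<in>I. Q i ^ n i)"
      using \<open>u \<noteq> 0\<close> by (simp only: smult_eq_0_iff power_eq_0_iff right_minus_eq) blast
    then show ?thesis
      by (simp add: line[symmetric] poly_prod)
  qed
  \<comment> \<open>The factor at t = 0, where x has become \<open>a\<close>: a polynomial in y with
    scalar coefficients.\<close>
  define r where "r i = smult (inverse (?ev a D)) (map_poly (?ev a) (q i))" for i
  have r: "map_poly (\<lambda>s. s $ 0) (Q i) = map_poly const_fract (r i)" for i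
  proof (rule poly_eqI)
    fix j
    have "inverse u $ 0 = const_fract (inverse (?ev a D))"
      by (simp only: fps_inverse_nth_0 u_def \<psi>0 const_fract_hom.hom_inverse)
    then show "coeff (map_poly (\<lambda>s. s $ 0) (Q i)) j = coeff (map_poly const_fract (r i)) j"
      by (simp add: coeff_map_poly Q_def r_def \<psi>0 const_fract_hom.hom_mult)
  qed
  \<comment> \<open>The cleared Bezout identity, specialized at \<open>a\<close>, has a nonzero
    scalar on its right-hand side.\<close>
  have cop: "coprime (map_poly const_fract (r i)) (map_poly const_fract (r j))"
    if ij: "i \<in> I" "j \<in> I" "i \<noteq> j" for i j
  proof (rule algebraic_semidom_class.coprimeI)
    fix c assume c: "c dvd map_poly const_fract (r i)" "c dvd map_poly const_fract (r j)"
    obtain A B where AB: "A * q i + B * q j = [:D ^ 2:]"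
      using comax[OF ij] by blast
    interpret mev: map_poly_comm_ring_hom "?ev a" ..
    interpret mK: map_poly_comm_ring_hom "const_fract :: 'a \<Rightarrow> _" ..
    define \<chi> where "\<chi> p = map_poly const_fract (map_poly (?ev a) p)" for p
    have \<chi>q: "\<chi> (q i) = smult (const_fract (?ev a D)) (map_poly const_fract (r i))" for i
      using Da by (simp add: \<chi>_def r_def const_fract_hom.map_poly_hom_smult const_fract_hom.hom_inverse)
    have "\<chi> (A * q i + B * q j) = [:const_fract (?ev a D) ^ 2:]"
      unfolding AB \<chi>_def
      by (simp add: ev.map_poly_pCons_hom const_fract_hom.map_poly_pCons_hom hom_distribs)
    then have "\<chi> A * \<chi> (q i) + \<chi> B * \<chi> (q j) = [:const_fract (?ev a D) ^ 2:]"
      by (simp add: \<chi>_def hom_distribs)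
    moreover have "c dvd \<chi> A * \<chi> (q i) + \<chi> B * \<chi> (q j)"
      unfolding \<chi>q using c by (intro dvd_add dvd_mult dvd_smult)
    ultimately have "c dvd [:const_fract (?ev a D) ^ 2:]"
      by simp
    moreover have "[:const_fract (?ev a D) ^ 2:] dvd 1"
      using Da by (simp add: is_unit_const_poly_iff dvd_field_iff)
    ultimately show "c dvd 1"
      by (rule dvd_trans)
  qed
  have Q0: "poly (Q i) (fps_const (const_fract \<beta>)) $ 0 = const_fract (poly (r i) \<beta>)" for i \<beta>
    by (simp add: poly_fps_const_nth r)
  \<comment> \<open>Every factor occurs in \<open>f\<close> with positive multiplicity, so none of
    them vanishes where \<open>f\<close> does not.\<close>
  have r0: "poly (r i) \<beta> \<noteq> 0" if "i \<in> I" "?ev (\<lambda>i. a i + \<beta> * b i) f \<noteq> 0" for i \<beta>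
  proof -
    have "line_series a b \<beta> f $ 0 \<noteq> 0"
      using that(2) by (simp add: line_series_nth_0)
    then have "(\<Prod>i\<in>I. poly (Q i) (fps_const (const_fract \<beta>)) ^ e i) $ 0 \<noteq> 0"
      unfolding factor[OF fact_f] by auto
    then have "poly (Q i) (fps_const (const_fract \<beta>)) $ 0 \<noteq> 0"
      using that(1) fin e by (auto simp: fps_nth_0_prod fps_nth_power_0)
    then show ?thesis
      by (simp add: Q0)
  qed
  have dlog_eq: "dlog (line_series a b \<beta> p) $ m =
      (\<Sum>i\<in>I. of_nat (n i) * dlog (poly (Q i) (fps_const (const_fract \<beta>))) $ m)"
    if p: "smult (D ^ sum n I) (\<Psi> p) = smult (lead_coeff (\<Psi> p)) (\<Prod>i\<in>I. q i ^ n i)" "p dvd f"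
      and \<beta>: "?ev (\<lambda>i. a i + \<beta> * b i) f \<noteq> 0" for p n \<beta> m
  proof -
    obtain h where "f = p * h"
      using p(2) by auto
    then have "lead_coeff (\<Psi> p) * lead_coeff (\<Psi> h) = mp_const c\<^sub>0"
      by (simp add: lc\<Psi>[symmetric] \<Psi>.hom_mult lead_coeff_mult)
    then obtain k where k: "k \<noteq> 0" "\<psi> (lead_coeff (\<Psi> p)) = fps_const k"
      unfolding \<psi>_def using line_series_const_if_mult_const b c\<^sub>0_def by metis
    have nz: "poly (Q i) (fps_const (const_fract \<beta>)) $ 0 \<noteq> 0" if "i \<in> I" for i
      using r0[OF that \<beta>] by (simp add: Q0)
    have "dlog (line_series a b \<beta> p) = (\<Sum>i\<in>I. of_nat (n i) * dlog (poly (Q i) (fps_const (const_fract \<beta>))))"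
      unfolding factor[OF p(1)] k(2) using k(1) nz fin
      by (simp add: dlog_mult dlog_prod dlog_power fps_nth_0_prod fps_nth_power_0)
    then show ?thesis
      by (simp add: fps_sum_nth fps_mult_of_nat_nth)
  qed
  show ?thesis
  proof (rule exI[of _ a], rule exI[of _ b], intro conjI allI impI)
    show "?ev a f \<noteq> 0" by (rule fa)
  next
    fix B m
    assume B: "finite B" "\<forall>\<beta>\<in>B. ?ev (\<lambda>i. a i + \<beta> * b i) f \<noteq> 0" "(m + 1) * total_degree f \<le> card B"
    have "\<exists>w. (\<Sum>i\<in>I. of_nat (k i) * dlog (poly (Q i) (fps_const (const_fract 0))) $ m) =
      (\<Sum>\<beta>\<in>B. const_fract (w \<beta>) * (\<Sum>i\<in>I. of_nat (e i) * dlog (poly (Q i) (fps_const (const_fract \<beta>))) $ m))"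
    proof (rule dlog_linear_combination[OF _ fin B(1) lcQ _ r cop])
      show "field_hom (const_fract :: 'a \<Rightarrow> _)" ..
      show "of_nat (e i) \<noteq> (0 :: 'a mpoly fract)" if "i \<in> I" for i
        using of_nat[OF e[OF that]] by (simp add: const_fract_hom.hom_of_nat[symmetric])
      show "poly (r i) \<beta> \<noteq> 0" if "i \<in> I" "\<beta> \<in> insert 0 B" for i \<beta>
        using that B(2) fa by (intro r0) auto
      have "(m + 1) * (\<Sum>i\<in>I. degree (Q i)) \<le> (m + 1) * d"
        using sum_deg by (intro mult_le_mono2) (simp add: degQ)
      also have "\<dots> \<le> card B"
        using B(3) by (simp add: d_def)
      finally show "(m + 1) * (\<Sum>i\<in>I. degree (Q i)) \<le> card B" .
    qed (auto simp: degQ degq)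
    then obtain w where w: "(\<Sum>i\<in>I. of_nat (k i) * dlog (poly (Q i) (fps_const (const_fract 0))) $ m) =
      (\<Sum>\<beta>\<in>B. const_fract (w \<beta>) * (\<Sum>i\<in>I. of_nat (e i) * dlog (poly (Q i) (fps_const (const_fract \<beta>))) $ m))"
      by blast
    have "dlog (line_series a b 0 g) $ m = (\<Sum>i\<in>I. of_nat (k i) * dlog (poly (Q i) (fps_const (const_fract 0))) $ m)"
      using fa by (intro dlog_eq[OF fact_g \<open>g dvd f\<close>]) simp
    moreover have "(\<Sum>\<beta>\<in>B. const_fract (w \<beta>) * dlog (line_series a b \<beta> f) $ m) =
      (\<Sum>\<beta>\<in>B. const_fract (w \<beta>) * (\<Sum>i\<in>I. of_nat (e i) * dlog (poly (Q i) (fps_const (const_fract \<beta>))) $ m))"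
      using B(2) by (intro sum.cong refl arg_cong[of _ _ "\<lambda>x. _ * x"] dlog_eq[OF fact_f]) auto
    ultimately show "\<exists>w. dlog (line_series a b 0 g) $ m =
        (\<Sum>\<beta>\<in>B. const_fract (w \<beta>) * dlog (line_series a b \<beta> f) $ m)"
      using w by (intro exI[of _ w]) (simp only:)
  qed
qed

section \<open>Truncated exponentials, logarithms and interpolation\<close>

lemma fps_power_nth_below:
  "a $ 0 = 0 \<Longrightarrow> n < k \<Longrightarrow> (a ^ k) $ n = 0" for a :: "'a::comm_ring_1 fps"
  using startsby_zero_power_prefix[of a k] by blast

lemma fps_deriv_const_mult_power:
  "fps_deriv (fps_const c * a ^ Suc k) = fps_const (c * of_nat (Suc k)) * (fps_deriv a * a ^ k)"
  for a :: "'a::comm_ring_1 fps"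
  by (simp add: fps_deriv_power mult_ac del: power_Suc of_nat_Suc flip: fps_const_mult)

text \<open>Both sides obey the recursion contained in \<open>fps_deriv G = dlog G * G\<close>. For
  the truncated exponential this holds up to order \<open>d\<close> because \<open>E ^ j\<close>
  starts at order \<open>j\<close> or later; coefficients of \<open>E\<close> beyond
  \<open>d\<close> are left open.\<close>

lemma exp_dlog_truncated:
  fixes G E :: "'a::field fps"
  assumes nat: "\<And>k. k > 0 \<Longrightarrow> of_nat k \<noteq> (0 :: 'a)" and G0: "G $ 0 \<noteq> 0" and E0: "E $ 0 = 0"
    and E: "\<And>m. m < d \<Longrightarrow> of_nat (m + 1) * E $ (m + 1) = dlog G $ m" and "m \<le> d"
  shows "G $ m = G $ 0 * (\<Sum>j\<le>d. fps_const (inverse (of_nat (fact j))) * E ^ j) $ m"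
proof -
  define W where "W n = (\<Sum>j\<le>n. fps_const (inverse (of_nat (fact j))) * E ^ j)" for n
  \<comment> \<open>Differentiation lowers the truncation index by one. \<open>W_eq\<close> repairs
    this, as the two truncations agree below order \<open>d\<close>.\<close>
  have deriv: "fps_deriv (W (Suc n)) = fps_deriv E * W n" for n
  proof (induction n)
    case 0
    show ?case by (simp add: W_def)
  next
    case (Suc n)
    have nz: "(of_nat (Suc k) :: 'a) \<noteq> 0" for k by (rule nat) simp
    have "inverse (of_nat (fact (Suc (Suc n)))) * of_nat (Suc (Suc n)) = (inverse (of_nat (fact (Suc n))) :: 'a)"
      using nz[of "Suc n"] by (simp only: fact_Suc[of "Suc n"] of_nat_mult of_nat_id) (simp add: field_simps del: of_nat_Suc fact_Suc)
    then have "fps_deriv (fps_const (inverse (of_nat (fact (Suc (Suc n))))) * E ^ Suc (Suc n))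
      = fps_deriv E * (fps_const (inverse (of_nat (fact (Suc n)))) * E ^ Suc n)"
      unfolding fps_deriv_const_mult_power by (simp only: mult_ac)
    then show ?case
      using Suc by (simp add: W_def distrib_left del: power_Suc fact_Suc)
  qed
  have W0: "W n $ 0 = 1" for n
    unfolding W_def fps_sum_nth by (subst sum.remove[of _ 0]) (simp_all add: E0 fps_nth_power_0)
  have "G $ m = G $ 0 * W d $ m"
    using \<open>m \<le> d\<close>
  proof (induction m rule: less_induct)
    case (less m)
    show ?case
    proof (cases m)
      case 0
      then show ?thesis by (simp add: W0)
    next
      case (Suc n)
      then have "n < d" using less.prems by simp
      then obtain d' where d: "d = Suc d'" by (cases d) auto
      have W_eq: "W d' $ i = W d $ i" if "i < d" for i
        unfolding d W_def using that by (simp add: d fps_power_nth_below[OF E0] del: power_Suc)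
      have "of_nat m * W d $ m = fps_deriv (W d) $ n"
        by (simp add: Suc)
      also have "\<dots> = (\<Sum>i=0..n. fps_deriv E $ i * W d' $ (n - i))"
        unfolding d deriv fps_mult_nth by simp
      also have "\<dots> = (\<Sum>i=0..n. dlog G $ i * W d $ (n - i))"
        using \<open>n < d\<close> E by (intro sum.cong refl arg_cong2[of _ _ _ _ "(*)"] W_eq) auto
      finally have eq: "of_nat m * W d $ m = (\<Sum>i=0..n. dlog G $ i * W d $ (n - i))" .
      have "of_nat m * (G $ 0 * W d $ m) = (\<Sum>i=0..n. dlog G $ i * (G $ 0 * W d $ (n - i)))"
        using arg_cong[OF eq, of "\<lambda>x. G $ 0 * x"] by (simp add: sum_distrib_left mult_ac)
      also have "\<dots> = (\<Sum>i=0..n. dlog G $ i * G $ (n - i))"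
        using less.prems Suc by (intro sum.cong refl arg_cong2[of _ _ _ _ "(*)"] less.IH[symmetric]) auto
      also have "\<dots> = (dlog G * G) $ n"
        by (simp add: fps_mult_nth)
      also have "dlog G * G = fps_deriv G * (inverse G * G)"
        by (simp add: dlog_def mult.assoc)
      also have "inverse G * G = 1"
        using G0 by (rule inverse_mult_eq_1)
      also have "(fps_deriv G * 1) $ n = of_nat m * G $ m"
        by (simp add: Suc)
      finally show ?thesis
        using nat[of m] Suc by simp
    qed
  qed
  then show ?thesis
    by (simp add: W_def)
qed

text \<open>As F is its constant term times 1 - U, the sum is the truncated series of ln (1 - U).
  Its derivative differs from \<open>dlog F\<close> only by a multiple of \<open>U ^ d\<close>,
  which starts at order \<open>d\<close> or later. The summand for \<open>j = 0\<close> vanishes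
  because \<open>inverse 0 = 0\<close>.\<close>

lemma log_truncated_nth:
  fixes F :: "'a::field fps"
  assumes nat: "\<And>k. k > 0 \<Longrightarrow> of_nat k \<noteq> (0 :: 'a)" and F0: "F $ 0 \<noteq> 0" and "m < d"
  defines "U \<equiv> 1 - fps_const (inverse (F $ 0)) * F"
  shows "of_nat (m + 1) * (\<Sum>j\<le>d. fps_const (- inverse (of_nat j)) * U ^ j) $ (m + 1) = dlog F $ m"
proof -
  define V where "V n = (\<Sum>j\<le>n. fps_const (- inverse (of_nat j)) * U ^ j)" for n
  have deriv: "(1 - U) * fps_deriv (V n) = - fps_deriv U * (1 - U ^ n)" for n
  proof (induction n)
    case 0
    show ?case by (simp add: V_def)
  next
    case (Suc n)
    have "(of_nat (Suc n) :: 'a) \<noteq> 0" by (rule nat) simp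
    then have "fps_deriv (fps_const (- inverse (of_nat (Suc n))) * U ^ Suc n) = - (fps_deriv U * U ^ n)"
      unfolding fps_deriv_const_mult_power by (simp del: of_nat_Suc flip: fps_const_neg)
    then have eq: "fps_deriv (V (Suc n)) = fps_deriv (V n) - fps_deriv U * U ^ n"
      by (simp add: V_def del: power_Suc)
    show ?case
      unfolding eq right_diff_distrib Suc by (simp add: algebra_simps)
  qed
  have U0: "U $ 0 = 0"
    using F0 by (simp add: U_def)
  have F: "F = fps_const (F $ 0) * (1 - U)"
    using F0 by (simp add: U_def mult.assoc[symmetric])
  have "fps_deriv F = - (fps_const (F $ 0) * fps_deriv U)"
    by (subst F) simp
  then have "F * fps_deriv (V d) = fps_deriv F * (1 - U ^ d)"
    by (subst F) (simp add: mult.assoc deriv)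
  then have "inverse F * (F * fps_deriv (V d)) = dlog F * (1 - U ^ d)"
    by (simp add: dlog_def mult_ac)
  also have "inverse F * (F * fps_deriv (V d)) = fps_deriv (V d)"
    using inverse_mult_eq_1[OF F0] by (simp add: mult.assoc[symmetric])
  finally have eq: "fps_deriv (V d) = dlog F * (1 - U ^ d)" .
  have "fps_deriv (V d) $ m = dlog F $ m - (dlog F * U ^ d) $ m"
    unfolding eq by (simp add: right_diff_distrib)
  moreover have "(dlog F * U ^ d) $ m = 0"
    unfolding fps_mult_nth using \<open>m < d\<close>
    by (intro sum.neutral) (auto simp: fps_power_nth_below[OF U0])
  ultimately show ?thesis
    by (simp add: V_def)
qed

text \<open>The weights are the coefficients of the Lagrange basis polynomials for the nodes
  \<open>T\<close>. Since the nodes are scalars, so are the weights, although \<open>p\<close> has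
  coefficients in the larger field; and they do not depend on \<open>p\<close>.\<close>

lemma coeff_interpolation:
  fixes h :: "'a::field \<Rightarrow> 'k::field"
  assumes "field_hom h" and fin: "finite T" and card: "card T > M"
  shows "\<exists>w. \<forall>p m. degree p \<le> M \<longrightarrow> coeff p m = (\<Sum>\<tau>\<in>T. h (w m \<tau>) * poly p (h \<tau>))"
proof -
  interpret h: field_hom h by fact
  define L where "L \<tau> = smult (inverse (\<Prod>\<sigma>\<in>T - {\<tau>}. \<tau> - \<sigma>)) (\<Prod>\<sigma>\<in>T - {\<tau>}. [:- \<sigma>, 1:])" for \<tau>
  have poly_L: "poly (L \<tau>) \<sigma> = (if \<sigma> = \<tau> then 1 else 0)" if "\<sigma> \<in> T" "\<tau> \<in> T" for \<sigma> \<tau>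
    using that fin by (auto simp: L_def poly_prod)
  have deg_L: "degree (L \<tau>) \<le> card T - 1" if "\<tau> \<in> T" for \<tau>
  proof -
    have "degree (\<Prod>\<sigma>\<in>T - {\<tau>}. [:- \<sigma>, 1:]) \<le> (\<Sum>\<sigma>\<in>T - {\<tau>}. 1)"
      using fin by (intro order.trans[OF degree_prod_sum_le] sum_mono) (auto simp: o_def)
    then show ?thesis
      using fin that order.trans[OF degree_smult_le] by (auto simp: L_def)
  qed
  have lagrange: "p = (\<Sum>\<tau>\<in>T. smult (poly p (h \<tau>)) (map_poly h (L \<tau>)))" if p: "degree p \<le> M" for p
  proof (rule ccontr)
    let ?q = "\<Sum>\<tau>\<in>T. smult (poly p (h \<tau>)) (map_poly h (L \<tau>))"
    assume "p \<noteq> ?q"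
    then have nz: "p - ?q \<noteq> 0" by simp
    have "degree ?q \<le> card T - 1"
      using fin deg_L order.trans[OF degree_smult_le order.trans[OF degree_map_poly_le]]
      by (intro degree_sum_le) blast+
    then have deg: "degree (p - ?q) \<le> card T - 1"
      using p card by (intro degree_diff_le) auto
    have "poly ?q (h \<sigma>) = poly p (h \<sigma>)" if "\<sigma> \<in> T" for \<sigma>
    proof -
      have "poly ?q (h \<sigma>) = (\<Sum>\<tau>\<in>T. if \<tau> = \<sigma> then poly p (h \<sigma>) else 0)"
        unfolding poly_sum by (intro sum.cong refl) (auto simp: poly_L that)
      then show ?thesis
        using fin that by simp
    qed
    then have "h ` T \<subseteq> {x. poly (p - ?q) x = 0}"
      by auto
    then have "card (h ` T) \<le> card {x. poly (p - ?q) x = 0}"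
      by (intro card_mono poly_roots_finite nz)
    also have "\<dots> \<le> degree (p - ?q)"
      by (rule card_poly_roots_bound) (rule nz)
    also have "card (h ` T) = card T"
      by (intro card_image) (simp add: inj_on_def)
    finally show False
      using deg card by simp
  qed
  have "coeff p m = (\<Sum>\<tau>\<in>T. h (coeff (L \<tau>) m) * poly p (h \<tau>))" if "degree p \<le> M" for p m
  proof -
    have "coeff p m = coeff (\<Sum>\<tau>\<in>T. smult (poly p (h \<tau>)) (map_poly h (L \<tau>))) m"
      by (rule arg_cong[where f = "\<lambda>p. coeff p m"]) (rule lagrange[OF that])
    then show ?thesis
      by (simp add: coeff_sum mult.commute)
  qed
  then show ?thesis
    by (intro exI[of _ "\<lambda>m \<tau>. coeff (L \<tau>) m"]) blast
qed

text \<open>The line at a fixed scalar parameter \<tau>. There the restriction is again a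
  multivariate polynomial, hence accessible to circuits.\<close>

definition line_subst :: "(nat \<Rightarrow> 'a::comm_ring_1) \<Rightarrow> (nat \<Rightarrow> 'a) \<Rightarrow> 'a \<Rightarrow> 'a \<Rightarrow> 'a mpoly \<Rightarrow> 'a mpoly" where
  "line_subst a b \<beta> \<tau> = affine_subst \<tau> (\<lambda>i. a i + \<beta> * b i - \<tau> * a i)"

lemma poly_line_poly: "poly (line_poly a b \<beta> p) (const_fract \<tau>) = to_fract (line_subst a b \<beta> \<tau> p)"
proof -
  have 1: "comm_ring_hom (\<lambda>P. poly P (const_fract \<tau>))"
    by unfold_locales simp_all
  have 2: "const_fract (a i + \<beta> * b i) + const_fract \<tau> * (to_fract (mp_var i) - const_fract (a i)) =
      to_fract (mp_const \<tau> * mp_var i + mp_const (a i + \<beta> * b i - \<tau> * a i))" for i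
    by (simp add: const_fract_def mp_const_hom.hom_add mp_const_hom.hom_mult mp_const_hom.hom_minus right_diff_distrib)
  show ?thesis
    unfolding line_poly_def line_subst_def affine_subst_def comm_ring_hom.hom_meval[OF 1] to_fract_hom.hom_meval 2[symmetric]
    by (simp add: const_fract_def)
qed

lemma line_subst_1: "line_subst a b 0 1 p = p"
  by (simp add: line_subst_def affine_subst_def meval_mp_var)

text \<open>The inner sums give the logarithm of the restriction of \<open>g\<close>, without
  constant term and up to order \<open>d\<close>, at t = \<sigma>; the outer sums give its
  exponential at t = 1. Coefficients in t are extracted twice, with nodes \<tau> for the logarithms
  and nodes \<sigma> for the exponential.\<close>

theorem factor_formula:
  fixes f g :: "'a::field mpoly"
  assumes char: "CHAR('a) = 0" and "f \<noteq> 0" "g dvd f"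
  defines "d \<equiv> total_degree f"
  obtains a b :: "nat \<Rightarrow> 'a" and B T :: "'a set" and u c\<^sub>1 c\<^sub>2 where
    "finite B" "finite T" "card B = (d + 1) ^ 2" "card T = (d + 1) ^ 2"
    "g = (\<Sum>\<sigma>\<in>T. \<Sum>j\<le>d. mp_const (c\<^sub>2 \<sigma> j) *
      (\<Sum>\<beta>\<in>B. \<Sum>\<tau>\<in>T. \<Sum>i\<le>d. mp_const (c\<^sub>1 \<sigma> \<beta> \<tau> i) *
        (1 + mp_const (u \<beta>) * line_subst a b \<beta> \<tau> f) ^ i) ^ j)"
proof -
  let ?ev = "meval (\<lambda>x :: 'a. x)"
  note of_nat = of_nat_neq_0_if_char_0[OF char]
  have of_nat_K: "of_nat n \<noteq> (0 :: 'a mpoly fract)" if "n > 0" for n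
    using of_nat[OF that] by (simp add: const_fract_hom.hom_of_nat[symmetric])
  have inf: "infinite (UNIV :: 'a set)"
    by (rule infinite_UNIV_if_char_0[OF char])
  obtain a b where fa: "?ev a f \<noteq> 0"
    and comb: "\<And>B m. finite B \<Longrightarrow> (\<forall>\<beta>\<in>B. ?ev (\<lambda>i. a i + \<beta> * b i) f \<noteq> 0) \<Longrightarrow>
      card B \<ge> (m + 1) * d \<Longrightarrow>
      \<exists>w. dlog (line_series a b 0 g) $ m = (\<Sum>\<beta>\<in>B. const_fract (w \<beta>) * dlog (line_series a b \<beta> f) $ m)"
    using dlog_factor_linear_combination[OF char assms(2,3)] unfolding d_def by blast
  let ?K = "const_fract :: 'a \<Rightarrow> _"
  define f\<^sub>0 where "f\<^sub>0 \<beta> = ?ev (\<lambda>i. a i + \<beta> * b i) f" for \<beta>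
  \<comment> \<open>Along a + \<beta> b the polynomial \<open>f\<close> is a nonzero polynomial in
    \<beta>, so only finitely many \<beta> are excluded.\<close>
  have "infinite {\<beta>. f\<^sub>0 \<beta> \<noteq> 0}"
  proof -
    define P where "P = meval (\<lambda>c. [:c:]) (\<lambda>i. [:a i, b i:]) f"
    have hom: "comm_ring_hom (\<lambda>p. poly p \<beta> :: 'a)" for \<beta>
      by unfold_locales simp_all
    have P: "poly P \<beta> = f\<^sub>0 \<beta>" for \<beta>
      unfolding P_def f\<^sub>0_def comm_ring_hom.hom_meval[OF hom] by simp
    have "P \<noteq> 0"
      using P[of 0] fa by (auto simp: f\<^sub>0_def)
    then have "finite {\<beta>. f\<^sub>0 \<beta> = 0}"
      using poly_roots_finite[of P] by (simp add: P)
    moreover have "UNIV = {\<beta>. f\<^sub>0 \<beta> = 0} \<union> {\<beta>. f\<^sub>0 \<beta> \<noteq> 0}"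
      by auto
    ultimately show ?thesis
      using inf by (metis finite_Un)
  qed
  then obtain B where B: "finite B" "card B = (d + 1) ^ 2" "B \<subseteq> {\<beta>. f\<^sub>0 \<beta> \<noteq> 0}"
    using infinite_arbitrarily_large by blast
  obtain T :: "'a set" where T: "finite T" "card T = (d + 1) ^ 2"
    using infinite_arbitrarily_large[OF inf] by blast
  have "\<exists>w. dlog (line_series a b 0 g) $ m = (\<Sum>\<beta>\<in>B. ?K (w \<beta>) * dlog (line_series a b \<beta> f) $ m)"
    if "m < d" for m
  proof (rule comb)
    have "(m + 1) * d \<le> (d + 1) * (d + 1)"
      using that by (intro mult_le_mono) auto
    then show "(m + 1) * d \<le> card B"
      by (simp add: B(2) power2_eq_square)
  qed (use B in \<open>auto simp: f\<^sub>0_def\<close>)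
  then have "\<exists>l. \<forall>m. m < d \<longrightarrow>
      dlog (line_series a b 0 g) $ m = (\<Sum>\<beta>\<in>B. ?K (l m \<beta>) * dlog (line_series a b \<beta> f) $ m)"
    by (intro choice) blast
  then obtain l where l: "\<And>m. m < d \<Longrightarrow>
      dlog (line_series a b 0 g) $ m = (\<Sum>\<beta>\<in>B. ?K (l m \<beta>) * dlog (line_series a b \<beta> f) $ m)"
    by blast
  have "field_hom ?K" ..
  moreover have "d * d < card T"
    by (simp add: T(2) power2_eq_square)
  ultimately obtain w where w: "\<And>p m. degree p \<le> d * d \<Longrightarrow> coeff p m = (\<Sum>\<tau>\<in>T. ?K (w m \<tau>) * poly p (?K \<tau>))"
    using coeff_interpolation[of ?K T "d * d"] T(1) by blast

  \<comment> \<open>For \<beta> in \<open>B\<close> this scaling gives \<open>U \<beta>\<close> the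
    constant term zero, as the logarithm series requires.\<close>
  define u where "u \<beta> = - inverse (f\<^sub>0 \<beta>)" for \<beta>
  define U where "U \<beta> = 1 + smult (?K (u \<beta>)) (line_poly a b \<beta> f)" for \<beta>
  define k where "k j = - inverse (of_nat j :: 'a)" for j :: nat
  \<comment> \<open>\<open>k 0 = 0\<close>, so that \<open>V\<close> is the truncation of the series of \<open>ln (1 - U)\<close>\<close>
  define V where "V \<beta> = (\<Sum>j\<le>d. smult (?K (k j)) (U \<beta> ^ j))" for \<beta>
  \<comment> \<open>Integration divides the \<open>m\<close>-th coefficient by \<open>m\<close> in
    \<open>E\<close> and in \<open>V\<close> alike, so the weights found for \<open>dlog\<close> at
    \<open>m - 1\<close> apply directly to the logarithms.\<close>
  define E where "E = (\<Sum>m=1..d. monom (\<Sum>\<beta>\<in>B. ?K (l (m - 1) \<beta>) * coeff (V \<beta>) m) m)"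
  define W where "W = (\<Sum>j\<le>d. smult (?K (inverse (of_nat (fact j)))) (E ^ j))"
  interpret lp: comm_ring_hom "line_poly a b 0"
    by (rule comm_ring_hom_line_poly)

  have deg_line: "degree (line_poly a b \<beta> f) \<le> d" for \<beta>
    unfolding line_poly_def d_def by (rule degree_meval_linear)
  have deg_pow: "degree (p ^ j) \<le> d * d" if "degree p \<le> d" "j \<le> d" for p :: "'a mpoly fract poly" and j
  proof -
    have "degree (p ^ j) \<le> degree p * j"
      by (rule degree_power_le)
    also have "\<dots> \<le> d * d"
      using that by (intro mult_le_mono) auto
    finally show ?thesis .
  qed
  have "degree (U \<beta>) \<le> d" for \<beta>
    unfolding U_def using deg_line[of \<beta>] by (intro degree_add_le) (auto intro: order.trans[OF degree_smult_le])
  then have deg_V: "degree (V \<beta>) \<le> d * d" for \<beta>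
    unfolding V_def by (intro degree_sum_le order.trans[OF degree_smult_le] deg_pow) auto
  have deg_E: "degree E \<le> d"
    unfolding E_def by (intro degree_sum_le order.trans[OF degree_monom_le]) auto
  then have deg_W: "degree W \<le> d * d"
    unfolding W_def by (intro degree_sum_le order.trans[OF degree_smult_le] deg_pow) auto

  have coeff_V: "of_nat (m + 1) * coeff (V \<beta>) (m + 1) = dlog (line_series a b \<beta> f) $ m"
    if "m < d" "\<beta> \<in> B" for m \<beta>
  proof -
    let ?F = "line_series a b \<beta> f"
    have F0: "?F $ 0 = ?K (f\<^sub>0 \<beta>)"
      by (simp add: line_series_nth_0 f\<^sub>0_def)
    then have "?F $ 0 \<noteq> 0"
      using B(3) that by auto
    have "fps_of_poly (U \<beta>) = 1 - fps_const (inverse (?F $ 0)) * ?F"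
      by (simp add: U_def u_def F0 fps_of_poly_add fps_of_poly_diff fps_of_poly_smult fps_of_line_poly
          const_fract_hom.hom_uminus const_fract_hom.hom_inverse flip: fps_const_neg)
    then have "fps_of_poly (V \<beta>) = (\<Sum>j\<le>d. fps_const (- inverse (of_nat j)) * (1 - fps_const (inverse (?F $ 0)) * ?F) ^ j)"
      by (simp add: V_def k_def fps_of_poly_sum fps_of_poly_uminus fps_of_poly_smult fps_of_poly_power
          const_fract_hom.hom_uminus const_fract_hom.hom_inverse const_fract_hom.hom_of_nat flip: fps_const_neg)
    then have "coeff (V \<beta>) (m + 1) = (\<Sum>j\<le>d. fps_const (- inverse (of_nat j)) * (1 - fps_const (inverse (?F $ 0)) * ?F) ^ j) $ (m + 1)"
      by (metis fps_of_poly_nth)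
    then show ?thesis
      using log_truncated_nth[OF of_nat_K \<open>?F $ 0 \<noteq> 0\<close> \<open>m < d\<close>] by simp
  qed
  have coeff_E: "coeff E m = (if m \<in> {1..d} then \<Sum>\<beta>\<in>B. ?K (l (m - 1) \<beta>) * coeff (V \<beta>) m else 0)" for m
    by (auto simp: E_def coeff_sum sum.delta)

  let ?G = "line_series a b 0 g"
  have gf: "line_poly a b 0 g dvd line_poly a b 0 f"
    using \<open>g dvd f\<close> by (rule lp.hom_dvd)
  have G0: "?G $ 0 = ?K (?ev a g)"
    by (simp add: line_series_nth_0)
  have "?ev a g \<noteq> 0"
  proof -
    interpret ev: comm_ring_hom "?ev a"
      by (rule comm_ring_hom_meval[OF comm_ring_hom_id])
    show ?thesis
      using ev.hom_dvd[OF \<open>g dvd f\<close>] fa by auto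
  qed
  have "line_poly a b 0 f \<noteq> 0"
  proof
    assume "line_poly a b 0 f = 0"
    then have "line_series a b 0 f $ 0 = 0"
      by (simp flip: fps_of_line_poly)
    then show False
      using fa by (simp add: line_series_nth_0)
  qed
  with gf have deg_G: "degree (line_poly a b 0 g) \<le> d"
    using dvd_imp_degree_le deg_line le_trans by blast
  \<comment> \<open>\<open>W\<close> may have degree up to \<open>d * d\<close>, but only its
    coefficients up to \<open>d\<close> belong to the restriction of \<open>g\<close>; the higher
    ones are discarded.\<close>
  have coeff_G: "coeff (line_poly a b 0 g) m = ?K (?ev a g) * coeff W m" if "m \<le> d" for m
  proof -
    have "?G $ m = ?G $ 0 * (\<Sum>j\<le>d. fps_const (inverse (of_nat (fact j))) * fps_of_poly E ^ j) $ m"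
    proof (rule exp_dlog_truncated[OF of_nat_K])
      show "?G $ 0 \<noteq> 0"
        using \<open>?ev a g \<noteq> 0\<close> by (simp add: G0)
      show "fps_of_poly E $ 0 = 0"
        by (simp add: coeff_E)
      show "of_nat (m + 1) * fps_of_poly E $ (m + 1) = dlog ?G $ m" if "m < d" for m
      proof -
        have "of_nat (m + 1) * fps_of_poly E $ (m + 1) =
            (\<Sum>\<beta>\<in>B. ?K (l m \<beta>) * (of_nat (m + 1) * coeff (V \<beta>) (m + 1)))"
          using that by (simp add: coeff_E sum_distrib_left mult.left_commute del: of_nat_Suc)
        also have "\<dots> = dlog ?G $ m"
          unfolding l[OF that] by (intro sum.cong refl arg_cong[of _ _ "\<lambda>x. _ * x"] coeff_V that)
        finally show ?thesis .
      qed
    qed (use that in auto)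
    also have "(\<Sum>j\<le>d. fps_const (inverse (of_nat (fact j))) * fps_of_poly E ^ j) = fps_of_poly W"
      by (simp add: W_def fps_of_poly_sum fps_of_poly_smult fps_of_poly_power
          const_fract_hom.hom_inverse const_fract_hom.hom_of_nat)
    finally show ?thesis
      unfolding G0 by (simp flip: fps_of_line_poly)
  qed

  define U' where "U' \<beta> \<tau> = 1 + mp_const (u \<beta>) * line_subst a b \<beta> \<tau> f" for \<beta> \<tau>
  \<comment> \<open>The factors are the power from evaluating \<open>E\<close> at \<sigma>, the
    weight for \<open>dlog\<close>, the interpolation weight and the coefficient of the logarithm
    series.\<close>
  define c\<^sub>1 where "c\<^sub>1 \<sigma> \<beta> \<tau> j = (\<Sum>m=1..d. \<sigma> ^ m * l (m - 1) \<beta> * w m \<tau> * k j)" for \<sigma> \<beta> \<tau> j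
  \<comment> \<open>Summing the interpolation weights over \<open>m\<close> reads off the value at t
    = 1, cut off at degree \<open>d\<close>.\<close>
  define c\<^sub>2 where "c\<^sub>2 \<sigma> j = ?ev a g * (\<Sum>m\<le>d. w m \<sigma>) * inverse (of_nat (fact j))" for \<sigma> j
  define E' where "E' \<sigma> = (\<Sum>\<beta>\<in>B. \<Sum>\<tau>\<in>T. \<Sum>j\<le>d. mp_const (c\<^sub>1 \<sigma> \<beta> \<tau> j) * U' \<beta> \<tau> ^ j)" for \<sigma>
  have cf: "to_fract (mp_const c) = ?K c" for c
    by (simp add: const_fract_def)
  have U': "poly (U \<beta>) (?K \<tau>) = to_fract (U' \<beta> \<tau>)" for \<beta> \<tau>
    by (simp add: U_def U'_def poly_line_poly cf)
  have coeff_V': "coeff (V \<beta>) m = (\<Sum>\<tau>\<in>T. ?K (w m \<tau>) * (\<Sum>j\<le>d. ?K (k j) * to_fract (U' \<beta> \<tau>) ^ j))" for \<beta> m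
    unfolding w[OF deg_V] by (simp add: V_def poly_sum U')
  have E': "poly E (?K \<sigma>) = to_fract (E' \<sigma>)" for \<sigma>
  proof -
    have "poly E (?K \<sigma>) = (\<Sum>m=1..d. \<Sum>\<beta>\<in>B. \<Sum>\<tau>\<in>T. \<Sum>j\<le>d.
        ?K (\<sigma> ^ m * l (m - 1) \<beta> * w m \<tau> * k j) * to_fract (U' \<beta> \<tau>) ^ j)"
      by (simp add: E_def poly_sum poly_monom coeff_V' sum_distrib_left sum_distrib_right
          const_fract_hom.hom_mult const_fract_hom.hom_power mult_ac)
    also have "\<dots> = (\<Sum>\<beta>\<in>B. \<Sum>\<tau>\<in>T. \<Sum>j\<le>d. \<Sum>m=1..d.
        ?K (\<sigma> ^ m * l (m - 1) \<beta> * w m \<tau> * k j) * to_fract (U' \<beta> \<tau>) ^ j)"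
      by (simp only: sum.swap[of _ _ "{1..d}"])
    also have "\<dots> = to_fract (E' \<sigma>)"
      by (simp add: E'_def c\<^sub>1_def cf to_fract_hom.hom_sum to_fract_hom.hom_power const_fract_hom.hom_sum sum_distrib_right)
    finally show ?thesis .
  qed
  have coeff_W: "coeff W m = (\<Sum>\<sigma>\<in>T. ?K (w m \<sigma>) * (\<Sum>j\<le>d. ?K (inverse (of_nat (fact j))) * to_fract (E' \<sigma>) ^ j))" for m
    unfolding w[OF deg_W] by (simp add: W_def poly_sum E')
  have "to_fract g = poly (line_poly a b 0 g) (?K 1)"
    unfolding poly_line_poly line_subst_1 ..
  also have "\<dots> = (\<Sum>m\<le>d. coeff (line_poly a b 0 g) m)"
    using deg_G by (simp add: poly_altdef sum.mono_neutral_left coeff_eq_0)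
  also have "\<dots> = (\<Sum>m\<le>d. \<Sum>\<sigma>\<in>T. \<Sum>j\<le>d. ?K (?ev a g * w m \<sigma> * inverse (of_nat (fact j))) * to_fract (E' \<sigma>) ^ j)"
    by (simp add: coeff_G coeff_W sum_distrib_left const_fract_hom.hom_mult mult_ac)
  also have "\<dots> = (\<Sum>\<sigma>\<in>T. \<Sum>j\<le>d. \<Sum>m\<le>d. ?K (?ev a g * w m \<sigma> * inverse (of_nat (fact j))) * to_fract (E' \<sigma>) ^ j)"
    by (subst sum.swap) (intro sum.cong refl sum.swap)
  also have "\<dots> = to_fract (\<Sum>\<sigma>\<in>T. \<Sum>j\<le>d. mp_const (c\<^sub>2 \<sigma> j) * E' \<sigma> ^ j)"
    by (simp add: c\<^sub>2_def cf to_fract_hom.hom_sum to_fract_hom.hom_power const_fract_hom.hom_sum sum_distrib_left sum_distrib_right)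
  finally have "g = (\<Sum>\<sigma>\<in>T. \<Sum>j\<le>d. mp_const (c\<^sub>2 \<sigma> j) * E' \<sigma> ^ j)"
    by (simp only: to_fract_eq_iff)
  then show thesis
    using that[OF B(1) T(1) B(2) T(2), of c\<^sub>2 c\<^sub>1 u a b] by (simp add: E'_def U'_def)
qed

section \<open>Circuits\<close>

definition gate_ok :: "nat \<Rightarrow> 'a gate \<Rightarrow> bool" where
  "gate_ok n g \<longleftrightarrow> (\<forall>j\<in>set (gate_children g). j < n) \<and>
    (case g of GAdd es \<Rightarrow> es \<noteq> [] | GMul es \<Rightarrow> es \<noteq> [] | _ \<Rightarrow> True)"

text \<open>Non-emptiness is left out so that circuits can be built and taken apart gate by gate,
  and several outputs can live in one gate list.\<close>

definition wf_gates :: "'a circuit \<Rightarrow> bool" where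
  "wf_gates C \<longleftrightarrow> (\<forall>i<length C. gate_ok i (C ! i))"

definition children :: "'a circuit \<Rightarrow> nat list" where
  "children C = concat (map gate_children C)"

lemma wf_circuit_iff: "wf_circuit C \<longleftrightarrow> C \<noteq> [] \<and> wf_gates C"
  by (simp add: wf_circuit_def wf_gates_def gate_ok_def)

lemma wf_gates_Nil [simp]: "wf_gates []"
  by (simp add: wf_gates_def)

lemma wf_gates_snoc [simp]: "wf_gates (C @ [g]) \<longleftrightarrow> wf_gates C \<and> gate_ok (length C) g"
  by (auto simp: wf_gates_def nth_append less_Suc_eq)

lemma children_Nil [simp]: "children [] = []"
  by (simp add: children_def)

lemma children_append [simp]: "children (C @ D) = children C @ children D"
  by (simp add: children_def)

lemma children_single [simp]: "children [g] = gate_children g"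
  by (simp add: children_def)

text \<open>A wire leads to a gate before the one that reads it, so the last gate is never read. The
  output of a formula is thus still free to receive one outgoing wire.\<close>

lemma wf_gates_children_less: "wf_gates C \<Longrightarrow> j \<in> set (children C) \<Longrightarrow> Suc j < length C"
  by (induction C rule: rev_induct) (auto simp: gate_ok_def)

lemma count_list_le_1_iff_distinct: "(\<forall>x. count_list xs x \<le> 1) \<longleftrightarrow> distinct xs"
proof (induction xs)
  case (Cons y xs)
  have "(\<forall>x. count_list (y # xs) x \<le> 1) \<longleftrightarrow> (\<forall>x. count_list xs x \<le> 1) \<and> count_list xs y = 0"
    by (auto simp: le_Suc_eq)
  then show ?case
    using Cons by (auto simp: count_list_0_iff)
qed simp

lemma is_formula_iff: "is_formula C \<longleftrightarrow> C \<noteq> [] \<and> wf_gates C \<and> distinct (children C)"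
  by (auto simp: is_formula_def wf_circuit_iff children_def count_list_le_1_iff_distinct[symmetric])

lemma circ_vals_Nil [simp]: "circ_vals [] = []"
  by (simp add: circ_vals_def)

lemma circ_vals_snoc [simp]: "circ_vals (C @ [g]) = circ_vals C @ [gate_val (circ_vals C) g]"
  by (simp add: circ_vals_def)

lemma length_circ_vals [simp]: "length (circ_vals C) = length C"
  by (induction C rule: rev_induct) simp_all

lemma circ_depths_Nil [simp]: "circ_depths [] = []"
  by (simp add: circ_depths_def)

lemma circ_depths_snoc [simp]: "circ_depths (C @ [g]) = circ_depths C @ [gate_depth (circ_depths C) g]"
  by (simp add: circ_depths_def)

lemma length_circ_depths [simp]: "length (circ_depths C) = length C"
  by (induction C rule: rev_induct) simp_all

lemma circ_size_Nil [simp]: "circ_size [] = 0"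
  by (simp add: circ_size_def)

lemma circ_size_append [simp]: "circ_size (C @ D) = circ_size C + circ_size D"
  by (simp add: circ_size_def)

lemma circ_size_single [simp]: "circ_size [g] = gate_fanin g"
  by (simp add: circ_size_def)

lemma length_gate_children: "length (gate_children g) = gate_fanin g"
  by (cases g) simp_all

lemma length_children: "length (children C) = circ_size C"
  by (induction C rule: rev_induct) (simp_all add: length_gate_children)

section \<open>Renumbering and copying of circuits\<close>

fun gate_remap :: "(nat \<Rightarrow> nat) \<Rightarrow> 'a gate \<Rightarrow> 'a gate" where
  "gate_remap \<phi> (GAdd es) = GAdd (map (map_prod \<phi> id) es)"
| "gate_remap \<phi> (GMul es) = GMul (map (map_prod \<phi> id) es)"
| "gate_remap \<phi> g = g"

lemma gate_children_remap [simp]: "gate_children (gate_remap \<phi> g) = map \<phi> (gate_children g)"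
  by (cases g) auto

lemma gate_fanin_remap [simp]: "gate_fanin (gate_remap \<phi> g) = gate_fanin g"
  by (cases g) auto

lemma gate_ok_remap:
  assumes "gate_ok n g" "\<And>j. j \<in> set (gate_children g) \<Longrightarrow> \<phi> j < m"
  shows "gate_ok m (gate_remap \<phi> g)"
  using assms by (cases g) (auto simp: gate_ok_def)

text \<open>Used with the identity for copies and with \<open>affine_subst\<close> for
  substitutions. The assumption on variable gates is separate because a substitution moves the
  variables.\<close>

lemma gate_val_remap:
  assumes "comm_ring_hom L" and "\<And>c. L (mp_const c) = mp_const c"
    and "\<And>i. g = GVar i \<Longrightarrow> L (mp_var i) = mp_var i"
    and "\<And>j. j \<in> set (gate_children g) \<Longrightarrow> vs' ! \<phi> j = L (vs ! j)"
  shows "gate_val vs' (gate_remap \<phi> g) = L (gate_val vs g)"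
proof -
  interpret comm_ring_hom L by fact
  have es: "map (\<lambda>(j, c). mp_const c * vs' ! j) (map (map_prod \<phi> id) es) = map L (map (\<lambda>(j, c). mp_const c * vs ! j) es)"
    if "\<And>j. j \<in> fst ` set es \<Longrightarrow> vs' ! \<phi> j = L (vs ! j)" for es
    using that by (auto simp: hom_mult assms(2) image_iff) (metis fst_conv)
  show ?thesis
  proof (cases g)
    case (GAdd es)
    then show ?thesis
      using es[of es] assms(4) by (simp only: gate_remap.simps gate_val.simps gate_children.simps hom_sum_list set_map)
  next
    case (GMul es)
    then show ?thesis
      using es[of es] assms(4) by (simp only: gate_remap.simps gate_val.simps gate_children.simps hom_prod_list set_map)
  qed (use assms in auto)
qed

lemma foldr_max_le:
  "(\<And>x. x \<in> set xs \<Longrightarrow> f x \<le> h x + k) \<Longrightarrow> foldr max (map f xs) 0 \<le> foldr max (map h xs) 0 + (k :: nat)"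
proof (induction xs)
  case (Cons a xs)
  then have "f a \<le> h a + k" "foldr max (map f xs) 0 \<le> foldr max (map h xs) 0 + k"
    by auto
  then show ?case
    by (simp add: le_max_iff_disj nat_add_max_left) linarith
qed simp

lemma gate_depth_remap_le:
  assumes "\<And>j. j \<in> set (gate_children g) \<Longrightarrow> ds' ! \<phi> j \<le> ds ! j + k"
  shows "gate_depth ds' (gate_remap \<phi> g) \<le> gate_depth ds g + k"
proof -
  have "foldr max (map (\<lambda>(j, c). ds' ! j) (map (map_prod \<phi> id) es)) 0 \<le> foldr max (map (\<lambda>(j, c). ds ! j) es) 0 + k"
    if "\<And>j. j \<in> fst ` set es \<Longrightarrow> ds' ! \<phi> j \<le> ds ! j + k" for es
    unfolding map_map o_def using that by (intro foldr_max_le) (auto simp: image_iff, metis fst_conv)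
  then show ?thesis
    using assms by (cases g) auto
qed

text \<open>The shifted gates of \<open>D\<close> read only each other, so both circuits keep their
  values and share no gate.\<close>

lemma shift_append:
  assumes "wf_gates D" "wf_gates C"
  defines "C' \<equiv> C @ map (gate_remap (\<lambda>j. length C + j)) D"
  shows "wf_gates C'" "circ_vals C' = circ_vals C @ circ_vals D"
    "\<And>i. i < length D \<Longrightarrow> circ_depths C' ! (length C + i) \<le> circ_depths D ! i"
    "\<And>i. i < length C \<Longrightarrow> circ_depths C' ! i = circ_depths C ! i"
    "children C' = children C @ map (\<lambda>j. length C + j) (children D)"
    "circ_size C' = circ_size C + circ_size D"
proof -
  let ?s = "\<lambda>j. length C + j"
  have "wf_gates (C @ map (gate_remap ?s) D) \<and> circ_vals (C @ map (gate_remap ?s) D) = circ_vals C @ circ_vals D \<and>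
    (\<forall>i<length D. circ_depths (C @ map (gate_remap ?s) D) ! (length C + i) \<le> circ_depths D ! i) \<and>
    (\<forall>i<length C. circ_depths (C @ map (gate_remap ?s) D) ! i = circ_depths C ! i) \<and>
    children (C @ map (gate_remap ?s) D) = children C @ map ?s (children D) \<and>
    circ_size (C @ map (gate_remap ?s) D) = circ_size C + circ_size D"
    using assms(1)
  proof (induction D rule: rev_induct)
    case Nil
    then show ?case using assms(2) by simp
  next
    case (snoc g D)
    let ?E = "C @ map (gate_remap ?s) D"
    have g: "gate_ok (length D) g" and IH: "wf_gates ?E" "circ_vals ?E = circ_vals C @ circ_vals D"
      "\<forall>i<length D. circ_depths ?E ! (length C + i) \<le> circ_depths D ! i"
      "\<forall>i<length C. circ_depths ?E ! i = circ_depths C ! i"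
      "children ?E = children C @ map ?s (children D)" "circ_size ?E = circ_size C + circ_size D"
      using snoc by auto
    have app: "C @ map (gate_remap ?s) (D @ [g]) = ?E @ [gate_remap ?s g]"
      by simp
    have child: "j < length D" if "j \<in> set (gate_children g)" for j
      using g that by (auto simp: gate_ok_def)
    have "gate_ok (length ?E) (gate_remap ?s g)"
      using child by (intro gate_ok_remap[OF g]) auto
    moreover have "gate_val (circ_vals ?E) (gate_remap ?s g) = gate_val (circ_vals D) g"
      by (rule gate_val_remap[OF comm_ring_hom_id]) (use child in \<open>auto simp: IH(2) nth_append\<close>)
    moreover have "gate_depth (circ_depths ?E) (gate_remap ?s g) \<le> gate_depth (circ_depths D) g + 0"
      by (rule gate_depth_remap_le) (use child IH(3) in auto)
    ultimately show ?case
      unfolding app wf_gates_snoc circ_vals_snoc circ_depths_snoc children_append circ_size_append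
      using IH by (auto simp: nth_append less_Suc_eq)
  qed
  then show "wf_gates C'" "circ_vals C' = circ_vals C @ circ_vals D"
    "\<And>i. i < length D \<Longrightarrow> circ_depths C' ! (length C + i) \<le> circ_depths D ! i"
    "\<And>i. i < length C \<Longrightarrow> circ_depths C' ! i = circ_depths C ! i"
    "children C' = children C @ map (\<lambda>j. length C + j) (children D)"
    "circ_size C' = circ_size C + circ_size D"
    unfolding C'_def by auto
qed

text \<open>The flag lets each construction be done once for circuits and formulas together. Size
  and depth are upper bounds, so that estimates can be relaxed.\<close>

definition computable :: "bool \<Rightarrow> 'a::comm_ring_1 mpoly \<Rightarrow> nat \<Rightarrow> nat \<Rightarrow> bool" where
  "computable formula p s \<Delta> \<longleftrightarrow> (\<exists>C. computes C p \<and> circ_size C \<le> s \<and> circ_depth C \<le> \<Delta> \<and> (formula \<longrightarrow> is_formula C))"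

lemma computable_mono: "computable fm p s \<Delta> \<Longrightarrow> s \<le> s' \<Longrightarrow> \<Delta> \<le> \<Delta>' \<Longrightarrow> computable fm p s' \<Delta>'"
  unfolding computable_def by (meson order.trans)

text \<open>The circuits stand one after the other, with outputs at the positions \<open>rs\<close>.
  Distinctness of \<open>children F @ rs\<close> is the invariant for formulas: the outputs are
  distinct and unread, so one new gate may read them all.\<close>

lemma circuit_forest:
  assumes "\<forall>C\<in>set Cs. wf_circuit C"
  shows "\<exists>F rs. wf_gates F \<and> length rs = length Cs \<and>
    (\<forall>i<length Cs. rs ! i < length F \<and> circ_vals F ! (rs ! i) = last (circ_vals (Cs ! i)) \<and>
      circ_depths F ! (rs ! i) \<le> circ_depth (Cs ! i)) \<and>
    circ_size F = (\<Sum>C\<leftarrow>Cs. circ_size C) \<and>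
    ((\<forall>C\<in>set Cs. is_formula C) \<longrightarrow> distinct (children F @ rs))"
  using assms
proof (induction Cs rule: rev_induct)
  case Nil
  show ?case by (intro exI[of _ "[]"]) simp
next
  case (snoc C Cs)
  then obtain F rs where F: "wf_gates F" "length rs = length Cs"
    "\<forall>i<length Cs. rs ! i < length F \<and> circ_vals F ! (rs ! i) = last (circ_vals (Cs ! i)) \<and>
      circ_depths F ! (rs ! i) \<le> circ_depth (Cs ! i)"
    "circ_size F = (\<Sum>C\<leftarrow>Cs. circ_size C)"
    "(\<forall>C\<in>set Cs. is_formula C) \<longrightarrow> distinct (children F @ rs)"
    by auto
  have C: "C \<noteq> []" "wf_gates C"
    using snoc.prems by (auto simp: wf_circuit_iff)
  define F' where "F' = F @ map (gate_remap (\<lambda>j. length F + j)) C"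
  note sh = shift_append[OF C(2) F(1), folded F'_def]
  define r where "r = length F + (length C - 1)"
  have lenF': "length F' = length F + length C"
    by (simp add: F'_def)
  have r: "r < length F'" "circ_vals F' ! r = last (circ_vals C)" "circ_depths F' ! r \<le> circ_depth C"
  proof -
    have ne: "circ_vals C \<noteq> []" "circ_depths C \<noteq> []"
      using C(1) by (metis length_0_conv length_circ_vals, metis length_0_conv length_circ_depths)
    show "r < length F'"
      using C(1) by (simp add: r_def lenF')
    show "circ_vals F' ! r = last (circ_vals C)"
      by (simp add: r_def sh(2) nth_append last_conv_nth[OF ne(1)])
    show "circ_depths F' ! r \<le> circ_depth C"
      using C(1) sh(3)[of "length C - 1"] by (simp add: r_def circ_depth_def last_conv_nth[OF ne(2)])
  qed
  have rs: "x < length F" if "x \<in> set rs" for x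
    using that F(2,3) by (auto simp: in_set_conv_nth)
  have dist: "distinct (children F' @ rs @ [r])" if "\<forall>C\<in>set (Cs @ [C]). is_formula C"
  proof -
    have "distinct (children F @ rs)" "distinct (children C)"
      using that F(5) by (auto simp: is_formula_iff)
    moreover have "x < length F" if "x \<in> set (children F)" for x
      using wf_gates_children_less[OF F(1) that] by simp
    moreover have "x < length C - 1" if "x \<in> set (children C)" for x
      using wf_gates_children_less[OF C(2) that] by simp
    ultimately show ?thesis
      using rs by (auto simp: sh(5) distinct_map inj_on_def r_def) (meson not_add_less1 less_irrefl)+
  qed
  show ?case
  proof (intro exI conjI)
    show "wf_gates F'" by (rule sh(1))
    show "length (rs @ [r]) = length (Cs @ [C])" using F(2) by simp
    show "circ_size F' = (\<Sum>C\<leftarrow>Cs @ [C]. circ_size C)"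
      using sh(6) F(4) by simp
    show "\<forall>i<length (Cs @ [C]). (rs @ [r]) ! i < length F' \<and>
      circ_vals F' ! ((rs @ [r]) ! i) = last (circ_vals ((Cs @ [C]) ! i)) \<and>
      circ_depths F' ! ((rs @ [r]) ! i) \<le> circ_depth ((Cs @ [C]) ! i)"
      using F(2,3) r sh(2,4) by (auto simp: nth_append less_Suc_eq lenF')
    show "(\<forall>C\<in>set (Cs @ [C]). is_formula C) \<longrightarrow> distinct (children F' @ rs @ [r])"
      using dist by blast
  qed
qed

lemma foldr_max_bound: "(\<And>x. x \<in> set xs \<Longrightarrow> x \<le> b) \<Longrightarrow> foldr max xs 0 \<le> (b :: nat)"
  by (induction xs) auto

text \<open>One gate on top of a forest: each entry costs its circuit and one wire, whose label
  carries the scalar. Lists are used because entries may repeat, as they do for powers.\<close>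

lemma computable_sum_prod_list:
  assumes "xs \<noteq> []" and comp: "\<And>x. x \<in> set xs \<Longrightarrow> computable fm (p x) s \<Delta>"
  shows "computable fm (\<Sum>x\<leftarrow>xs. mp_const (c x) * p x) (length xs * (s + 1)) (\<Delta> + 1)"
    and "computable fm (\<Prod>x\<leftarrow>xs. mp_const (c x) * p x) (length xs * (s + 1)) (\<Delta> + 1)"
proof -
  obtain C where C: "\<And>x. x \<in> set xs \<Longrightarrow> computes (C x) (p x) \<and> circ_size (C x) \<le> s \<and>
      circ_depth (C x) \<le> \<Delta> \<and> (fm \<longrightarrow> is_formula (C x))"
    using comp unfolding computable_def by metis
  have "\<forall>D\<in>set (map C xs). wf_circuit D"
    using C by (auto simp: computes_def)
  from circuit_forest[OF this] obtain F rs where F: "wf_gates F" "length rs = length xs"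
    "\<And>i. i < length xs \<Longrightarrow> rs ! i < length F \<and> circ_vals F ! (rs ! i) = last (circ_vals (C (xs ! i))) \<and>
      circ_depths F ! (rs ! i) \<le> circ_depth (C (xs ! i))"
    "circ_size F = (\<Sum>x\<leftarrow>xs. circ_size (C x))"
    "(\<forall>x\<in>set xs. is_formula (C x)) \<longrightarrow> distinct (children F @ rs)"
    by (auto simp: o_def)
  define es where "es = zip rs (map c xs)"
  have fst_es: "map fst es = rs" and "es \<noteq> []"
    using F(2) \<open>xs \<noteq> []\<close> by (auto simp: es_def)
  have vals: "map (\<lambda>(j, c). mp_const c * circ_vals F ! j) es = map (\<lambda>x. mp_const (c x) * p x) xs"
    using F(2,3) C by (intro nth_equalityI) (auto simp: es_def computes_def)
  have rs: "x < length F \<and> circ_depths F ! x \<le> \<Delta>" if "x \<in> set rs" for x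
    using that F(2,3) C by (fastforce simp: in_set_conv_nth)
  have "circ_size F \<le> (\<Sum>x\<leftarrow>xs. s)"
    unfolding F(4) using C by (intro sum_list_mono) auto
  then have size: "circ_size F + length es \<le> length xs * (s + 1)"
    using F(2) by (simp add: sum_list_triv es_def)
  have ok: "gate_ok (length F) (GAdd es)" "gate_ok (length F) (GMul es)"
    using rs \<open>es \<noteq> []\<close> fst_es by (auto simp: gate_ok_def)
  have "foldr max (map (\<lambda>(j, c). circ_depths F ! j) es) 0 \<le> \<Delta>"
  proof (rule foldr_max_bound)
    fix x assume "x \<in> set (map (\<lambda>(j, c). circ_depths F ! j) es)"
    then obtain j c where "(j, c) \<in> set es" "x = circ_depths F ! j"
      by auto
    moreover from this have "j \<in> set rs"
      unfolding fst_es[symmetric] by force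
    ultimately show "x \<le> \<Delta>"
      using rs by blast
  qed
  then have depth: "gate_depth (circ_depths F) (GAdd es) \<le> \<Delta> + 1" "gate_depth (circ_depths F) (GMul es) \<le> \<Delta> + 1"
    by auto
  have formula: "distinct (children F @ rs)" if fm
    using that C F(5) by auto
  show "computable fm (\<Sum>x\<leftarrow>xs. mp_const (c x) * p x) (length xs * (s + 1)) (\<Delta> + 1)"
    unfolding computable_def
    by (intro exI[of _ "F @ [GAdd es]"])
      (use F(1) ok depth size formula in \<open>auto simp: computes_def circ_depth_def is_formula_iff wf_circuit_iff fst_es vals\<close>)
  show "computable fm (\<Prod>x\<leftarrow>xs. mp_const (c x) * p x) (length xs * (s + 1)) (\<Delta> + 1)"
    unfolding computable_def
    by (intro exI[of _ "F @ [GMul es]"])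
      (use F(1) ok depth size formula in \<open>auto simp: computes_def circ_depth_def is_formula_iff wf_circuit_iff fst_es vals\<close>)
qed

lemma computable_linear_combination:
  assumes "finite A" "A \<noteq> {}" and comp: "\<And>x. x \<in> A \<Longrightarrow> computable fm (p x) s \<Delta>"
  shows "computable fm (\<Sum>x\<in>A. mp_const (c x) * p x) (card A * (s + 1)) (\<Delta> + 1)"
proof -
  obtain xs where xs: "set xs = A" "distinct xs"
    using finite_distinct_list[OF \<open>finite A\<close>] by blast
  have "computable fm (\<Sum>x\<leftarrow>xs. mp_const (c x) * p x) (length xs * (s + 1)) (\<Delta> + 1)"
    using assms(2) comp xs by (intro computable_sum_prod_list(1)) auto
  moreover have "length xs = card A"
    using xs distinct_card by metis
  ultimately show ?thesis
    using xs by (simp only: sum_list_distinct_conv_sum_set)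
qed

lemma computable_const: "computable fm (mp_const c) s \<Delta>"
  unfolding computable_def
  by (intro exI[of _ "[GConst c]"])
    (simp add: computes_def wf_circuit_def circ_vals_def circ_size_def circ_depth_def circ_depths_def is_formula_def)

lemma computable_power:
  assumes "computable fm p s \<Delta>"
  shows "computable fm (p ^ j) (j * (s + 1)) (\<Delta> + 1)"
proof (cases "j = 0")
  case True
  then show ?thesis
    using computable_const[of fm 1] by simp
next
  case False
  \<comment> \<open>The base is copied \<open>j\<close> times instead of being read by
    \<open>j\<close> wires, which a formula would not allow.\<close>
  then have "computable fm (\<Prod>x\<leftarrow>replicate j (). mp_const 1 * p) (length (replicate j ()) * (s + 1)) (\<Delta> + 1)"
    using assms by (intro computable_sum_prod_list(2)) auto
  moreover have "(\<Prod>x\<leftarrow>replicate j (). mp_const 1 * p) = p ^ j"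
    by (induction j) auto
  ultimately show ?thesis
    by simp
qed

section \<open>Affine substitution in circuits\<close>

lemma circ_vals_append_nth: "i < length C \<Longrightarrow> circ_vals (C @ D) ! i = circ_vals C ! i"
  by (induction D rule: rev_induct) (simp_all add: nth_append flip: append_assoc)

lemma circ_depths_append_nth: "i < length C \<Longrightarrow> circ_depths (C @ D) ! i = circ_depths C ! i"
  by (induction D rule: rev_induct) (simp_all add: nth_append flip: append_assoc)

text \<open>Variable gates outside \<open>S\<close> (in the application: gates without outgoing wires) are not expanded,
  because only the wires, not the gates, of a circuit are counted by its size.\<close>
lemma affine_subst_circuit:
  assumes "wf_gates C" "set (children C) \<subseteq> S"
  shows "\<exists>C' \<phi>. wf_gates C' \<and> (\<forall>i<length C. \<phi> i < length C') \<and> inj_on \<phi> {..<length C} \<and>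
    (\<forall>i<length C. i \<in> S \<longrightarrow> circ_vals C' ! \<phi> i = affine_subst \<tau> \<gamma> (circ_vals C ! i)) \<and>
    (\<forall>i<length C. circ_depths C' ! \<phi> i \<le> circ_depths C ! i + 1) \<and>
    circ_size C' \<le> circ_size C + 2 * card (S \<inter> {..<length C}) \<and>
    (C \<noteq> [] \<longrightarrow> length C' = \<phi> (length C - 1) + 1) \<and>
    (\<forall>i<length C. \<phi> i \<in> set (children C') \<longrightarrow> i \<in> set (children C)) \<and>
    (distinct (children C) \<longrightarrow> distinct (children C'))"
  using assms
proof (induction C rule: rev_induct)
  case Nil
  show ?case by (intro exI[of _ "[]"]) simp
next
  case (snoc g C)
  then have g: "gate_ok (length C) g" and wfC: "wf_gates C" and gS: "set (gate_children g) \<subseteq> S"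
    by auto
  obtain C' \<phi> where IH: "wf_gates C'" "\<And>i. i < length C \<Longrightarrow> \<phi> i < length C'" "inj_on \<phi> {..<length C}"
    "\<And>i. i < length C \<Longrightarrow> i \<in> S \<Longrightarrow> circ_vals C' ! \<phi> i = affine_subst \<tau> \<gamma> (circ_vals C ! i)"
    "\<And>i. i < length C \<Longrightarrow> circ_depths C' ! \<phi> i \<le> circ_depths C ! i + 1"
    "circ_size C' \<le> circ_size C + 2 * card (S \<inter> {..<length C})"
    "\<And>i. i < length C \<Longrightarrow> \<phi> i \<in> set (children C') \<Longrightarrow> i \<in> set (children C)"
    "distinct (children C) \<Longrightarrow> distinct (children C')"
    using snoc by auto
  have child: "j < length C" if "j \<in> set (gate_children g)" for j
    using g that by (auto simp: gate_ok_def)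
  have C'_less: "j < length C'" if "j \<in> set (children C')" for j
    using wf_gates_children_less[OF IH(1) that] by simp
  let ?S = "\<lambda>C. card (S \<inter> {..<length C})"
  have card_S: "?S (C @ [g]) = ?S C + (if length C \<in> S then 1 else 0)"
    by (simp add: lessThan_Suc)
  \<comment> \<open>\<open>D\<close> is the block of gates that replaces \<open>g\<close>, its last
    gate standing for \<open>g\<close>. It reads only images of children of \<open>g\<close> and
    gates of its own, which keeps all children distinct.\<close>
  obtain D where D: "D \<noteq> []" "wf_gates (C' @ D)"
    "length C \<in> S \<Longrightarrow> last (circ_vals (C' @ D)) = affine_subst \<tau> \<gamma> (gate_val (circ_vals C) g)"
    "last (circ_depths (C' @ D)) \<le> gate_depth (circ_depths C) g + 1"
    "circ_size D \<le> gate_fanin g + 2 * (if length C \<in> S then 1 else 0)"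
    "\<And>j. j \<in> set (children D) \<Longrightarrow> j \<in> \<phi> ` set (gate_children g) \<or> length C' \<le> j"
    "distinct (gate_children g) \<Longrightarrow> distinct (children D)"
  proof (cases "\<exists>i. g = GVar i")
    case True
    then obtain i where i: "g = GVar i" by auto
    let ?n = "length C'"
    show thesis
    proof (cases "length C \<in> S")
      case True
      \<comment> \<open>A variable whose value matters becomes a sum of the variable and the
        constant 1, weighted on the wires: two wires and one layer.\<close>
      define A where "A = (C' @ [GVar i]) @ [GConst 1]"
      have A: "wf_gates A" "circ_vals A = circ_vals C' @ [mp_var i, mp_const 1]" "circ_depths A = circ_depths C' @ [0, 0]"
        by (simp_all add: A_def IH(1) gate_ok_def del: append_assoc)
      have app: "C' @ [GVar i, GConst 1, GAdd [(?n, \<tau>), (?n + 1, \<gamma> i)]] = A @ [GAdd [(?n, \<tau>), (?n + 1, \<gamma> i)]]"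
        by (simp add: A_def)
      show thesis
      proof (rule that[of "[GVar i, GConst 1, GAdd [(?n, \<tau>), (?n + 1, \<gamma> i)]]"], goal_cases)
        case 2
        show ?case
          unfolding app by (simp add: A(1), simp add: A_def gate_ok_def)
      next
        case 3
        show ?case
          unfolding app circ_vals_snoc A(2) by (simp add: i nth_append)
      next
        case 4
        show ?case
          unfolding app circ_depths_snoc A(3) by (simp add: i nth_append)
      qed (use True in \<open>auto simp: children_def circ_size_def\<close>)
    next
      case False
      \<comment> \<open>Outside \<open>S\<close> no value is prescribed, so a constant takes the
        place of the variable without any wire; some gate has to stand there for the
        renumbering.\<close>
      show thesis
        by (rule that[of "[GConst 0]"]) (use False i IH(1) in \<open>auto simp: gate_ok_def\<close>)
    qed
  next
    case False
    have ok: "gate_ok (length C') (gate_remap \<phi> g)"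
      using child IH(2) by (intro gate_ok_remap[OF g]) auto
    have val: "gate_val (circ_vals C') (gate_remap \<phi> g) = affine_subst \<tau> \<gamma> (gate_val (circ_vals C) g)"
      by (rule gate_val_remap[OF comm_ring_hom_affine_subst]) (use False child gS IH(4) in auto)
    have depth: "gate_depth (circ_depths C') (gate_remap \<phi> g) \<le> gate_depth (circ_depths C) g + 1"
      by (rule gate_depth_remap_le) (use child IH(5) in auto)
    have "distinct (map \<phi> (gate_children g))" if "distinct (gate_children g)"
      using that child IH(3) by (auto simp: distinct_map intro: inj_on_subset)
    then show thesis
      by (intro that[of "[gate_remap \<phi> g]"]) (use ok val depth IH(1) in auto)
  qed
  define \<psi> where "\<psi> = \<phi>(length C := length (C' @ D) - 1)"
  have \<psi>: "\<psi> i = \<phi> i" if "i < length C" for i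
    using that by (simp add: \<psi>_def)
  have \<psi>_last: "\<psi> (length C) = length (C' @ D) - 1" "length C' \<le> \<psi> (length C)"
    using D(1) by (auto simp: \<psi>_def Suc_le_eq) (metis One_nat_def Suc_leI le_add_diff_inverse length_greater_0_conv le_add1 add_diff_assoc)
  have ne: "circ_vals (C' @ D) \<noteq> []" "circ_depths (C' @ D) \<noteq> []"
    using D(1) by (metis append_is_Nil_conv length_0_conv length_circ_vals,
        metis append_is_Nil_conv length_0_conv length_circ_depths)
  have less_Suc: "i < length (C @ [g]) \<longleftrightarrow> i < length C \<or> i = length C" for i
    by auto
  show ?case
  proof (intro exI[of _ "C' @ D"] exI[of _ \<psi>] conjI allI impI)
    show "wf_gates (C' @ D)" by (rule D(2))
    show "\<psi> i < length (C' @ D)" if "i < length (C @ [g])" for i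
      using that IH(2) \<psi> \<psi>_last(1) D(1) unfolding less_Suc by (auto simp: trans_less_add1)
    show "inj_on \<psi> {..<length (C @ [g])}"
    proof (rule inj_onI)
      fix i j assume "i \<in> {..<length (C @ [g])}" "j \<in> {..<length (C @ [g])}" and eq: "\<psi> i = \<psi> j"
      then consider "i < length C" "j < length C" | "i < length C" "j = length C" | "i = length C" "j < length C" | "i = j"
        by force
      then show "i = j"
      proof cases
        case 1
        then show ?thesis using eq IH(3) by (auto simp: \<psi> inj_on_def)
      next
        case 2
        then show ?thesis using eq IH(2)[of i] \<psi>_last(2) by (auto simp: \<psi>)
      next
        case 3
        then show ?thesis using eq IH(2)[of j] \<psi>_last(2) by (auto simp: \<psi>)
      qed
    qed
    show "circ_vals (C' @ D) ! \<psi> i = affine_subst \<tau> \<gamma> (circ_vals (C @ [g]) ! i)"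
      if "i < length (C @ [g])" "i \<in> S" for i
      using that(1) unfolding less_Suc
    proof
      assume "i < length C"
      then show ?thesis
        using IH(2,4) that(2) by (simp add: \<psi> circ_vals_append_nth nth_append)
    next
      assume i: "i = length C"
      then show ?thesis
        using D(3) that(2) last_conv_nth[OF ne(1)] by (simp add: \<psi>_last(1) nth_append)
    qed
    show "circ_depths (C' @ D) ! \<psi> i \<le> circ_depths (C @ [g]) ! i + 1" if "i < length (C @ [g])" for i
      using that unfolding less_Suc
    proof
      assume "i < length C"
      then show ?thesis
        using IH(2,5) by (simp add: \<psi> circ_depths_append_nth nth_append)
    next
      assume i: "i = length C"
      then show ?thesis
        using D(4) last_conv_nth[OF ne(2)] by (simp add: \<psi>_last(1) nth_append)
    qed
    show "circ_size (C' @ D) \<le> circ_size (C @ [g]) + 2 * ?S (C @ [g])"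
      using IH(6) D(5) card_S by simp
    show "length (C' @ D) = \<psi> (length (C @ [g]) - 1) + 1"
      using D(1) \<psi>_last by (simp add: Suc_diff_1)
    show "i \<in> set (children (C @ [g]))" if i: "i < length (C @ [g])" "\<psi> i \<in> set (children (C' @ D))" for i
      using i(1) unfolding less_Suc
    proof
      assume lt: "i < length C"
      then consider "\<phi> i \<in> set (children C')" | "\<phi> i \<in> set (children D)"
        using i(2) by (auto simp: \<psi>)
      then show ?thesis
      proof cases
        case 1
        then show ?thesis using IH(7)[OF lt] by simp
      next
        case 2
        then obtain k where "k \<in> set (gate_children g)" "\<phi> i = \<phi> k"
          using D(6) IH(2)[OF lt] by fastforce
        then show ?thesis
          using IH(3) lt child[of k] by (auto simp: inj_on_def)
      qed
    next
      assume "i = length C"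
      then show ?thesis
        using wf_gates_children_less[OF D(2) i(2)] \<psi>_last(1) D(1) by simp
    qed
    show "distinct (children (C' @ D))" if "distinct (children (C @ [g]))"
    proof -
      have "False" if j: "j \<in> set (children C')" "j \<in> set (children D)" for j
      proof -
        obtain k where k: "k \<in> set (gate_children g)" "j = \<phi> k"
          using D(6)[OF j(2)] C'_less[OF j(1)] by auto
        then have "k \<in> set (children C)"
          using IH(7)[OF child[OF k(1)]] j(1) by simp
        then show False
          using k(1) \<open>distinct (children (C @ [g]))\<close> by auto
      qed
      then show ?thesis
        using that IH(8) D(7) by auto
    qed
  qed
qed

text \<open>\<open>S\<close> consists of the output and the gates that are read, at most s + 1 in
  all. Each may cost two more wires, whence s + 2 (s + 1). Only leaves are expanded, so a single
  layer is added.\<close>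

lemma computable_affine_subst:
  assumes "computable fm p s \<Delta>"
  shows "computable fm (affine_subst \<tau> \<gamma> p) (3 * s + 2) (\<Delta> + 1)"
proof -
  obtain C where C: "computes C p" "circ_size C \<le> s" "circ_depth C \<le> \<Delta>" "fm \<longrightarrow> is_formula C"
    using assms by (auto simp: computable_def)
  define n where "n = length C - 1"
  define S where "S = insert n (set (children C))"
  have wf: "C \<noteq> []" "wf_gates C" and p: "last (circ_vals C) = p"
    using C(1) by (auto simp: computes_def wf_circuit_iff)
  have n: "n < length C" using wf(1) by (simp add: n_def)
  have sub: "set (children C) \<subseteq> S" by (auto simp: S_def)
  obtain C' \<phi> where C': "wf_gates C'" "\<And>i. i < length C \<Longrightarrow> \<phi> i < length C'"
    "\<And>i. i < length C \<Longrightarrow> i \<in> S \<Longrightarrow> circ_vals C' ! \<phi> i = affine_subst \<tau> \<gamma> (circ_vals C ! i)"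
    "\<And>i. i < length C \<Longrightarrow> circ_depths C' ! \<phi> i \<le> circ_depths C ! i + 1"
    "circ_size C' \<le> circ_size C + 2 * card (S \<inter> {..<length C})" "length C' = \<phi> n + 1"
    "distinct (children C) \<Longrightarrow> distinct (children C')"
    using affine_subst_circuit[OF wf(2) sub, of \<tau> \<gamma>] wf(1) unfolding n_def by blast
  have last: "last xs = xs ! \<phi> n" if "length xs = length C'" for xs :: "'b list"
    using that C'(6) by (subst last_conv_nth) auto
  have last_C: "last xs = xs ! n" if "length xs = length C" for xs :: "'b list"
    using that n by (subst last_conv_nth) (auto simp: n_def)
  have "card (S \<inter> {..<length C}) \<le> card S"
    by (intro card_mono) (auto simp: S_def)
  also have "\<dots> \<le> Suc (card (set (children C)))"
    unfolding S_def by (rule card_insert_le_m1) auto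
  also have "card (set (children C)) \<le> circ_size C"
    using card_length[of "children C"] by (simp add: length_children)
  finally have "circ_size C' \<le> 3 * s + 2"
    using C'(5) C(2) by linarith
  moreover have "C' \<noteq> []"
    using C'(6) by auto
  moreover have "last (circ_vals C') = affine_subst \<tau> \<gamma> p"
    using C'(3)[OF n] p last[of "circ_vals C'"] last_C[of "circ_vals C"] by (simp add: S_def)
  moreover have "circ_depth C' \<le> \<Delta> + 1"
    using C'(4)[OF n] C(3) last[of "circ_depths C'"] last_C[of "circ_depths C"] by (simp add: circ_depth_def)
  ultimately show ?thesis
    using C(4) C'(1,7) by (auto simp: computable_def computes_def wf_circuit_iff is_formula_iff intro!: exI[of _ C'])
qed

text \<open>The six layers are the substitution, the sum \<open>U\<close>, a power, the combination
  \<open>E\<close>, a power, and the outer combination. With \<open>N\<close> at least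
  \<open>s\<close> and d + 1, the size of \<open>U\<close> is linear in \<open>N\<close>, each power
  costs a factor \<open>N\<close>, and the combinations have (d + 1)^5 and (d + 1)^3 terms: 1 + 1 +
  5 + 1 + 3 = 11.\<close>

lemma computable_factor:
  fixes f g :: "'a::field mpoly"
  assumes char: "CHAR('a) = 0" and "f \<noteq> 0" "g dvd f" and f: "computable formula f s \<Delta>"
  shows "computable formula g (16 * (s + total_degree f + 1) ^ 11) (\<Delta> + 6)"
proof -
  define d where "d = total_degree f"
  define N where "N = s + d + 1"
  obtain a b :: "nat \<Rightarrow> 'a" and B T u c\<^sub>1 c\<^sub>2 where fin: "finite B" "finite T"
    and card: "card B = (d + 1) ^ 2" "card T = (d + 1) ^ 2"
    and g: "g = (\<Sum>\<sigma>\<in>T. \<Sum>j\<le>d. mp_const (c\<^sub>2 \<sigma> j) *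
      (\<Sum>\<beta>\<in>B. \<Sum>\<tau>\<in>T. \<Sum>i\<le>d. mp_const (c\<^sub>1 \<sigma> \<beta> \<tau> i) *
        (1 + mp_const (u \<beta>) * line_subst a b \<beta> \<tau> f) ^ i) ^ j)"
  proof (rule factor_formula[OF assms(1-3), folded d_def])
  qed (rule that)
  have ne: "B \<noteq> {}" "T \<noteq> {}"
    using card by auto
  have sN: "s \<le> N" and dN: "d + 1 \<le> N" and N1: "1 \<le> N"
    by (simp_all add: N_def)
  define U where "U \<beta> \<tau> = 1 + mp_const (u \<beta>) * line_subst a b \<beta> \<tau> f" for \<beta> \<tau>
  \<comment> \<open>Summing over a product set makes the nested sums a single addition gate, hence a
    single layer.\<close>
  define E where "E \<sigma> = (\<Sum>x\<in>B \<times> T \<times> {..d}. mp_const (case x of (\<beta>, \<tau>, i) \<Rightarrow> c\<^sub>1 \<sigma> \<beta> \<tau> i) *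
      (case x of (\<beta>, \<tau>, i) \<Rightarrow> U \<beta> \<tau> ^ i))" for \<sigma>
  have g_eq: "g = (\<Sum>x\<in>T \<times> {..d}. mp_const (case x of (\<sigma>, j) \<Rightarrow> c\<^sub>2 \<sigma> j) * (case x of (\<sigma>, j) \<Rightarrow> E \<sigma> ^ j))"
  proof -
    have "E \<sigma> = (\<Sum>\<beta>\<in>B. \<Sum>\<tau>\<in>T. \<Sum>i\<le>d. mp_const (c\<^sub>1 \<sigma> \<beta> \<tau> i) * U \<beta> \<tau> ^ i)" for \<sigma>
      unfolding E_def by (simp only: sum.cartesian_product case_prod_unfold fst_conv snd_conv)
    then show ?thesis
      unfolding g by (simp only: sum.cartesian_product case_prod_unfold U_def[symmetric])
  qed

  have power_bound: "j * (M + 1) \<le> N * (M + 1)" if "j \<le> d" for j M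
    using that dN by (intro mult_le_mono1) simp

  have U: "computable formula (U \<beta> \<tau>) (6 * N + 6) (\<Delta> + 2)" for \<beta> \<tau>
  proof -
    have L: "computable formula (line_subst a b \<beta> \<tau> f) (3 * N + 2) (\<Delta> + 1)"
      unfolding line_subst_def
      by (rule computable_mono[OF computable_affine_subst[OF f]]) (use sN in auto)
    have "computable formula (\<Sum>x\<leftarrow>[(1, 1), (line_subst a b \<beta> \<tau> f, u \<beta>)]. mp_const (snd x) * fst x)
        (length [(1, 1), (line_subst a b \<beta> \<tau> f, u \<beta>)] * (3 * N + 2 + 1)) (\<Delta> + 1 + 1)"
      by (rule computable_sum_prod_list(1)) (use L computable_const[of formula 1] in auto)
    moreover have "(\<Sum>x\<leftarrow>[(1, 1), (line_subst a b \<beta> \<tau> f, u \<beta>)]. mp_const (snd x) * fst x) = U \<beta> \<tau>"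
      by (simp add: U_def)
    ultimately have "computable formula (U \<beta> \<tau>) (length [(1, 1), (line_subst a b \<beta> \<tau> f, u \<beta>)] * (3 * N + 2 + 1)) (\<Delta> + 1 + 1)"
      by (simp only:)
    then show ?thesis
      by (rule computable_mono) simp_all
  qed
  \<comment> \<open>6 N + 7 is at most 13 N. From here on the leading constant grows by one per
    stage to absorb the extra wire of each copy.\<close>
  have U_power: "computable formula (U \<beta> \<tau> ^ i) (13 * N ^ 2) (\<Delta> + 3)" if "i \<le> d" for \<beta> \<tau> i
  proof -
    have "i * (6 * N + 6 + 1) \<le> N * (6 * N + 6 + 1)"
      using that by (rule power_bound)
    also have "\<dots> \<le> N * (13 * N)"
      using N1 by (intro mult_le_mono2) simp
    finally show ?thesis
      using computable_mono[OF computable_power[OF U, of \<beta> \<tau> i], of "13 * N ^ 2" "\<Delta> + 3"]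
      by (simp add: power2_eq_square)
  qed
  have E: "computable formula (E \<sigma>) (14 * N ^ 7) (\<Delta> + 4)" for \<sigma>
  proof -
    have "computable formula (E \<sigma>) (card (B \<times> T \<times> {..d}) * (13 * N ^ 2 + 1)) (\<Delta> + 3 + 1)"
      unfolding E_def using fin ne U_power by (intro computable_linear_combination) auto
    moreover have "card (B \<times> T \<times> {..d}) = (d + 1) ^ 5"
    proof -
      have "x ^ 2 * (x ^ 2 * x) = x ^ 5" for x :: nat
        by (simp add: eval_nat_numeral)
      then show ?thesis
        by (simp only: card card_cartesian_product card_atMost Suc_eq_plus1)
    qed
    moreover have "(d + 1) ^ 5 * (13 * N ^ 2 + 1) \<le> 14 * N ^ 7"
    proof -
      have "(d + 1) ^ 5 * (13 * N ^ 2 + 1) \<le> N ^ 5 * (14 * N ^ 2)"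
        using dN N1 by (intro mult_le_mono power_mono) auto
      then show ?thesis
        by (simp only: mult.left_commute[of _ 14] mult.left_commute[of _ 16] flip: power_add) simp
    qed
    ultimately show ?thesis
      by (elim computable_mono) simp_all
  qed
  have E_power: "computable formula (E \<sigma> ^ j) (15 * N ^ 8) (\<Delta> + 5)" if "j \<le> d" for \<sigma> j
  proof -
    have "j * (14 * N ^ 7 + 1) \<le> N * (14 * N ^ 7 + 1)"
      using that by (rule power_bound)
    also have "\<dots> \<le> N * (15 * N ^ 7)"
      using N1 by (intro mult_le_mono2) simp
    also have "\<dots> = 15 * N ^ 8"
      by (simp only: mult.left_commute[of _ 15] flip: power_Suc) simp
    finally show ?thesis
      using computable_mono[OF computable_power[OF E, of \<sigma> j], of "15 * N ^ 8" "\<Delta> + 5"] by simp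
  qed
  have "computable formula g (card (T \<times> {..d}) * (15 * N ^ 8 + 1)) (\<Delta> + 5 + 1)"
    unfolding g_eq using fin ne E_power by (intro computable_linear_combination) auto
  moreover have "card (T \<times> {..d}) = (d + 1) ^ 3"
    by (simp only: card card_cartesian_product card_atMost Suc_eq_plus1) (simp only: power3_eq_cube power2_eq_square)
  moreover have "(d + 1) ^ 3 * (15 * N ^ 8 + 1) \<le> 16 * N ^ 11"
  proof -
    have "(d + 1) ^ 3 * (15 * N ^ 8 + 1) \<le> N ^ 3 * (16 * N ^ 8)"
      using dN N1 by (intro mult_le_mono power_mono) auto
    then show ?thesis
      by (simp only: mult.left_commute[of _ 14] mult.left_commute[of _ 16] flip: power_add) simp
  qed
  ultimately have "computable formula g (16 * N ^ 11) (\<Delta> + 6)"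
    by (elim computable_mono) simp_all
  then show ?thesis
    by (simp add: N_def d_def)
qed

theorem theorem1p1:
  assumes "CHAR('a::field) = 0"
  shows "\<exists>(K::nat) (k::nat) (c::nat).
    \<forall>(n::nat) (f::'a mpoly) (g::'a mpoly).
      f \<noteq> 0 \<and> in_vars n f \<and> in_vars n g \<and> g dvd f \<longrightarrow>
      (\<forall>C. computes C f \<longrightarrow>
         (\<exists>C'. computes C' g \<and>
            circ_size C' \<le> K * (circ_size C + total_degree f + n + 1) ^ k \<and>
            circ_depth C' \<le> circ_depth C + c)) \<and>
      (\<forall>F. is_formula F \<and> computes F f \<longrightarrow>
         (\<exists>F'. is_formula F' \<and> computes F' g \<and>
            circ_size F' \<le> K * (circ_size F + total_degree f + n + 1) ^ k))"
proof -
  have bound: "16 * (s + total_degree f + 1) ^ 11 \<le> 16 * (s + total_degree f + n + 1) ^ 11"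
    for s n and f :: "'a mpoly"
    by (intro mult_le_mono2 power_mono) auto
  show ?thesis
  proof (rule exI[of _ 16], rule exI[of _ 11], rule exI[of _ 6], intro allI impI conjI)
    fix n :: nat and f g :: "'a mpoly" and C
    assume *: "f \<noteq> 0 \<and> in_vars n f \<and> in_vars n g \<and> g dvd f" and C: "computes C f"
    have "computable False f (circ_size C) (circ_depth C)"
      using C by (auto simp: computable_def)
    then have "computable False g (16 * (circ_size C + total_degree f + 1) ^ 11) (circ_depth C + 6)"
      using * by (intro computable_factor[OF assms]) auto
    then show "\<exists>C'. computes C' g \<and> circ_size C' \<le> 16 * (circ_size C + total_degree f + n + 1) ^ 11 \<and>
        circ_depth C' \<le> circ_depth C + 6"
      using bound[of "circ_size C" f n] unfolding computable_def by (blast intro: order.trans)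
  next
    fix n :: nat and f g :: "'a mpoly" and F
    assume *: "f \<noteq> 0 \<and> in_vars n f \<and> in_vars n g \<and> g dvd f" and F: "is_formula F \<and> computes F f"
    have "computable True f (circ_size F) (circ_depth F)"
      using F by (auto simp: computable_def)
    then have "computable True g (16 * (circ_size F + total_degree f + 1) ^ 11) (circ_depth F + 6)"
      using * by (intro computable_factor[OF assms]) auto
    then show "\<exists>F'. is_formula F' \<and> computes F' g \<and> circ_size F' \<le> 16 * (circ_size F + total_degree f + n + 1) ^ 11"
      using bound[of "circ_size F" f n] unfolding computable_def by (blast intro: order.trans)
  qed
qed

end
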